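(* Let $X:=(X_1,\ldots,X_N)$ be a (not necessarily time homogeneous) Markov chain, taking values in a Polish state space $\Lambda=\Lambda_1\times\cdots\times\Lambda_N$, with mixing time $\tau(\epsilon)$ (for $0\le\epsilon\le1$). Let $$\tau_{\min}:=\inf_{0\le\epsilon<1}\tau(\epsilon)\cdot\left(\frac{2-\epsilon}{1-\epsilon}\right)^2.$$ Suppose that $f:\Lambda\to\mathbb{R}$ is measurable and that for some $c\in\mathbb{R}_+^N$, $$f(x)-f(y)\le\sum_{i=1}^{N}c_i\,\mathbf{1}[x_i\ne y_i]\quad\text{for every }x,y\in\Lambda.$$ Then for any $t\ge0$, $$\mathbb{P}\left(|f(X)-\mathbb{E}f(X)|\ge t\right)\le2\exp\left(\frac{-2t^2}{\|c\|^2\tau_{\min}}\right).$$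
   Context: $\|c\|$ is the Euclidean norm. For probability distributions, $d_{\mathrm{TV}}(P,Q)=\sup_A|P(A)-Q(A)|$. For a Markov chain $X_1,\ldots,X_N$ with $X_i\in\Lambda_i$, let $\mathcal{L}(X_{i+t}|X_i=x)$ be the conditional distribution of $X_{i+t}$ given $X_i=x$ (defined through the transition kernels of the chain), and set $$\overline d(t):=\max_{1\le i\le N-t}\ \sup_{x,y\in\Lambda_i}d_{\mathrm{TV}}\left(\mathcal{L}(X_{i+t}|X_i=x),\mathcal{L}(X_{i+t}|X_i=y)\right),\qquad\tau(\epsilon):=\min\{t\in\mathbb{N}:\overline d(t)\le\epsilon\},$$ where $\mathbb{N}=\{1,2,\ldots\}$ and a maximum over the empty set is $0$. *)

theory Defs
  imports "HOL-Probability.Probability"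
begin

definition polish_topology :: "'a topology \<Rightarrow> bool" where
  "polish_topology T \<longleftrightarrow> completely_metrizable_space T \<and> separable_space T"

definition borel_sets_of :: "'a topology \<Rightarrow> 'a measure" where
  "borel_sets_of T = sigma (topspace T) {U. openin T U}"

text \<open>The state spaces \<open>\<Lambda>\<^sub>1, \<dots>, \<Lambda>\<^sub>N\<close> are given by topologies \<open>T 1, \<dots>, T N\<close> on arbitrary carriers inside
  one type; they may be different spaces. Since they are second countable, the product
  \<open>\<sigma>\<close>-algebra below is the Borel \<open>\<sigma>\<close>-algebra of the product topology.\<close>

definition path_space :: "(nat \<Rightarrow> 'a topology) \<Rightarrow> nat \<Rightarrow> (nat \<Rightarrow> 'a) measure" where
  "path_space T n = (\<Pi>\<^sub>M i\<in>{1..n}. borel_sets_of (T i))"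

definition sample_path :: "(nat \<Rightarrow> 'w \<Rightarrow> 'a) \<Rightarrow> nat \<Rightarrow> 'w \<Rightarrow> nat \<Rightarrow> 'a" where
  "sample_path X n \<omega> = (\<lambda>i\<in>{1..n}. X i \<omega>)"

text \<open>\<open>X 1, \<dots>, X N\<close> is a Markov chain on the probability space \<open>P\<close>, where \<open>K i\<close> is the transition
  kernel from \<open>\<Lambda>\<^sub>i\<close> to \<open>\<Lambda>\<^sub>i\<^sub>+\<^sub>1\<close>. The last condition is
  \<open>P(X\<^sub>i\<^sub>+\<^sub>1 \<in> A | X\<^sub>1, \<dots>, X\<^sub>i) = K\<^sub>i(X\<^sub>i, A)\<close> almost surely.\<close>

definition markov_chain ::
  "'w measure \<Rightarrow> nat \<Rightarrow> (nat \<Rightarrow> 'a topology) \<Rightarrow> (nat \<Rightarrow> 'a \<Rightarrow> 'a measure) \<Rightarrow> (nat \<Rightarrow> 'w \<Rightarrow> 'a) \<Rightarrow> bool"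
where
  "markov_chain P N T K X \<longleftrightarrow>
     prob_space P \<and>
     (\<forall>i\<in>{1..N}. X i \<in> measurable P (borel_sets_of (T i))) \<and>
     (\<forall>i\<in>{1..<N}. K i \<in> measurable (borel_sets_of (T i)) (prob_algebra (borel_sets_of (T (Suc i))))) \<and>
     (\<forall>i\<in>{1..<N}. \<forall>A\<in>sets (borel_sets_of (T (Suc i))).
        AE \<omega> in P.
          real_cond_exp P (vimage_algebra (space P) (sample_path X i) (path_space T i))
            (\<lambda>\<omega>'. indicator A (X (Suc i) \<omega>')) \<omega>
          = measure (K i (X i \<omega>)) A)"

text \<open>\<open>cond_law T K i t x\<close> is the law of \<open>X\<^sub>i\<^sub>+\<^sub>t\<close> given \<open>X\<^sub>i = x\<close>, obtained by composing
  the kernels \<open>K i, \<dots>, K (i + t - 1)\<close>.\<close>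

primrec cond_law ::
  "(nat \<Rightarrow> 'a topology) \<Rightarrow> (nat \<Rightarrow> 'a \<Rightarrow> 'a measure) \<Rightarrow> nat \<Rightarrow> nat \<Rightarrow> 'a \<Rightarrow> 'a measure"
where
  "cond_law T K i 0 x = return (borel_sets_of (T i)) x"
| "cond_law T K i (Suc t) x = cond_law T K i t x \<bind> K (i + t)"

text \<open>Only meant for probability measures with the same \<open>\<sigma>\<close>-algebra.\<close>

definition tv_dist :: "'a measure \<Rightarrow> 'a measure \<Rightarrow> real" where
  "tv_dist P Q = (SUP A\<in>sets P. \<bar>measure P A - measure Q A\<bar>)"

definition dbar :: "nat \<Rightarrow> (nat \<Rightarrow> 'a topology) \<Rightarrow> (nat \<Rightarrow> 'a \<Rightarrow> 'a measure) \<Rightarrow> nat \<Rightarrow> real" where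
  "dbar N T K t =
     (if N \<le> t then 0
      else Max ((\<lambda>i. SUP (x, y)\<in>topspace (T i) \<times> topspace (T i).
                        tv_dist (cond_law T K i t x) (cond_law T K i t y)) ` {1..N - t}))"

text \<open>The minimum is over \<open>t \<ge> 1\<close>; it exists for \<open>\<epsilon> \<ge> 0\<close> because \<open>dbar\<close> vanishes for \<open>t \<ge> N\<close>.\<close>

definition mixing_time :: "nat \<Rightarrow> (nat \<Rightarrow> 'a topology) \<Rightarrow> (nat \<Rightarrow> 'a \<Rightarrow> 'a measure) \<Rightarrow> real \<Rightarrow> nat" where
  "mixing_time N T K \<epsilon> = (LEAST t. 1 \<le> t \<and> dbar N T K t \<le> \<epsilon>)"

definition tau_min :: "nat \<Rightarrow> (nat \<Rightarrow> 'a topology) \<Rightarrow> (nat \<Rightarrow> 'a \<Rightarrow> 'a measure) \<Rightarrow> real" where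
  "tau_min N T K =
     (INF \<epsilon>\<in>{0..<1}. real (mixing_time N T K \<epsilon>) * ((2 - \<epsilon>) / (1 - \<epsilon>))\<^sup>2)"

text \<open>\<open>exp (a / v)\<close> for \<open>a \<le> 0 \<le> v\<close>, with \<open>exp (- \<infinity>) = 0\<close> when \<open>a < 0 = v\<close> (where division by
  zero would give \<open>1\<close>); the value for \<open>a = v = 0\<close> is \<open>1\<close>.\<close>

definition exp_quot :: "real \<Rightarrow> real \<Rightarrow> real" where
  "exp_quot a v = (if v = 0 \<and> a < 0 then 0 else exp (a / v))"

end

theory Submission
  imports Defs
begin

text \<open>
  Cut the path into blocks of length \<open>\<tau> = \<tau>(\<epsilon>)\<close>, write \<open>C\<^sub>k\<close> for the sum of the \<open>c\<^sub>j\<close> over block \<open>k\<close>,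
  and consider the Doob martingale of \<open>f(X)\<close> along the block boundaries. Its \<open>k\<close>-th increment has
  conditional range at most \<open>C\<^sub>k + B\<^sub>k\<close>, where \<open>B\<^sub>k\<close> bounds how much the conditional mean depends on the
  last state of block \<open>k\<close>, and \<open>B\<^sub>k = C\<^sub>k\<^sub>+\<^sub>1 + \<epsilon> B\<^sub>k\<^sub>+\<^sub>1\<close>: the next block costs its full weight, and what
  follows it costs only in so far as the last state of that block remembers the past. Hence
  \<open>\<Sum> (C\<^sub>k + B\<^sub>k)\<^sup>2 \<le> ((2 - \<epsilon>) / (1 - \<epsilon>))\<^sup>2 \<Sum> C\<^sub>k\<^sup>2\<close> with \<open>C\<^sub>k\<^sup>2 \<le> \<tau> \<Sum> c\<^sub>j\<^sup>2\<close> in each block, and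
  Hoeffding's lemma and the Chernoff bound conclude.

  The recursion for \<open>B\<^sub>k\<close> is usually obtained by coupling the last states of a block and resampling
  the rest. Here no coupling is built: writing both integrals as integrals of tail probabilities,
  it suffices to compare \<open>\<mu>(G > s + C)\<close> with \<open>\<nu>(G > s)\<close>, and inner regularity (where the Polish
  assumption enters) allows projecting a compact part of \<open>{G > s + C}\<close> to the last state.
\<close>

section \<open>Inner regularity on finite products of Polish spaces\<close>

text \<open>Good-sets argument: the sets that can be approximated from inside together with their
  complements form a sigma-algebra. Approximability of a set alone says nothing about its
  complement, hence the separate hypothesis on complements of generators.\<close>

lemma (in finite_measure) inner_regular_sigma_sets:
  assumes gen: "sets M = sigma_sets (space M) G"
    and sub: "\<K> \<subseteq> sets M" and empty: "{} \<in> \<K>"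
    and Un: "\<And>A B. A \<in> \<K> \<Longrightarrow> B \<in> \<K> \<Longrightarrow> A \<union> B \<in> \<K>"
    and Int: "\<And>K :: nat \<Rightarrow> 'a set. range K \<subseteq> \<K> \<Longrightarrow> (\<Inter>n. K n) \<in> \<K>"
    and inner_space: "\<And>e. 0 < e \<Longrightarrow> \<exists>K\<in>\<K>. measure M (space M - K) \<le> e"
    and inner_gen: "\<And>A e. A \<in> G \<Longrightarrow> 0 < e \<Longrightarrow> \<exists>K\<in>\<K>. K \<subseteq> A \<and> measure M (A - K) \<le> e"
    and inner_co: "\<And>A e. A \<in> G \<Longrightarrow> 0 < e \<Longrightarrow>
            \<exists>K\<in>\<K>. K \<subseteq> space M - A \<and> measure M ((space M - A) - K) \<le> e"
    and A: "A \<in> sets M" and e: "0 < e"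
  shows "\<exists>K\<in>\<K>. K \<subseteq> A \<and> measure M (A - K) \<le> e"
proof -
  define inner where
    "inner A \<longleftrightarrow> (\<forall>e>0. \<exists>K\<in>\<K>. K \<subseteq> A \<and> measure M (A - K) \<le> e)" for A
  have KM: "K \<in> \<K> \<Longrightarrow> K \<in> sets M" for K using sub by auto
  \<comment> \<open>The errors \<open>e * (1/2) ^ Suc n\<close> sum to \<open>e\<close>. The union
    and the intersection of the \<open>A n\<close> both exceed that of the \<open>K n\<close> by a
    subset of \<open>\<Union>n. A n - K n\<close>, so one choice serves both.\<close>
  have pick: "\<exists>K. (\<forall>n. K n \<in> \<K> \<and> K n \<subseteq> A n) \<and> measure M (\<Union>n. A n - K n) \<le> e"
    if "\<And>n. inner (A n)" and AM: "\<And>n. A n \<in> sets M" and "0 < e" for A :: "nat \<Rightarrow> 'a set" and e :: real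
  proof -
    have "\<forall>n. \<exists>K\<in>\<K>. K \<subseteq> A n \<and> measure M (A n - K) \<le> e * (1/2) ^ Suc n"
    proof
      fix n
      have "0 < e * (1/2) ^ Suc n" using \<open>0 < e\<close> by simp
      then show "\<exists>K\<in>\<K>. K \<subseteq> A n \<and> measure M (A n - K) \<le> e * (1/2) ^ Suc n"
        using that(1)[of n] unfolding inner_def by blast
    qed
    then obtain K where K: "\<And>n. K n \<in> \<K>" "\<And>n. K n \<subseteq> A n"
        "\<And>n. measure M (A n - K n) \<le> e * (1/2) ^ Suc n"
      by metis
    have s: "(\<lambda>n. e * (1/2) ^ Suc n) sums e"
      using sums_mult[OF power_half_series, of e] by simp
    have sm: "summable (\<lambda>n. measure M (A n - K n))"
      by (rule summable_comparison_test'[OF sums_summable[OF s], of 0]) (use K(3) in auto)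
    have "measure M (\<Union>n. A n - K n) \<le> (\<Sum>n. measure M (A n - K n))"
      by (rule finite_measure_subadditive_countably) (use AM KM K sm in auto)
    also have "\<dots> \<le> (\<Sum>n. e * (1/2) ^ Suc n)"
      by (rule suminf_le[OF K(3) sm sums_summable[OF s]])
    also have "\<dots> = e" using s by (simp add: sums_iff)
    finally show ?thesis using K by blast
  qed
  have inner_UN: "inner (\<Union>n. A n)"
    if A: "\<And>n. inner (A n)" and AM: "\<And>n. A n \<in> sets M" for A :: "nat \<Rightarrow> 'a set"
    unfolding inner_def
  proof (intro allI impI)
    fix e :: real assume "0 < e"
    obtain K where K: "\<And>n. K n \<in> \<K>" "\<And>n. K n \<subseteq> A n" "measure M (\<Union>n. A n - K n) \<le> e / 2"
      using pick[of A "e/2"] A AM half_gt_zero[OF \<open>0 < e\<close>] by blast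
    \<comment> \<open>Only finite unions stay in \<open>\<K>\<close>, so the countable union is
      truncated, at the price of the second \<open>e / 2\<close>.\<close>
    define L where "L m = (\<Union>n\<le>m. K n)" for m
    have L: "L m \<in> \<K>" for m
      by (induction m) (auto simp: L_def atMost_Suc K intro: Un)
    have inc: "incseq L" unfolding incseq_def L_def by (intro allI impI UN_mono) auto
    have LU: "(\<Union>m. L m) = (\<Union>n. K n)" by (auto simp: L_def)
    have "(\<lambda>m. measure M (L m)) \<longlonglongrightarrow> measure M (\<Union>n. K n)"
      using finite_Lim_measure_incseq[OF _ inc] L KM LU by auto
    then have "eventually (\<lambda>m. measure M (\<Union>n. K n) - e / 2 < measure M (L m)) sequentially"
      by (rule order_tendstoD) (use \<open>0 < e\<close> in auto)
    then obtain m where m: "measure M (\<Union>n. K n) - e / 2 < measure M (L m)"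
      by (auto simp: eventually_sequentially)
    have "measure M ((\<Union>n. A n) - L m) \<le> measure M ((\<Union>n. A n - K n) \<union> ((\<Union>n. K n) - L m))"
      by (rule finite_measure_mono) (use AM KM K L in auto)
    also have "\<dots> \<le> measure M (\<Union>n. A n - K n) + measure M ((\<Union>n. K n) - L m)"
      by (rule measure_Un_le) (use AM KM K L in auto)
    also have "measure M ((\<Union>n. K n) - L m) = measure M (\<Union>n. K n) - measure M (L m)"
      by (rule finite_measure_Diff) (use KM K L LU in auto)
    finally have "measure M ((\<Union>n. A n) - L m) \<le> e" using K(3) m by linarith
    moreover have "L m \<subseteq> (\<Union>n. A n)" using K(2) by (auto simp: L_def)
    ultimately show "\<exists>K\<in>\<K>. K \<subseteq> (\<Union>n. A n) \<and> measure M ((\<Union>n. A n) - K) \<le> e"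
      using L by blast
  qed
  have inner_INT: "inner (\<Inter>n. A n)"
    if A: "\<And>n. inner (A n)" and AM: "\<And>n. A n \<in> sets M" for A :: "nat \<Rightarrow> 'a set"
    unfolding inner_def
  proof (intro allI impI)
    fix e :: real assume "0 < e"
    obtain K where K: "\<And>n. K n \<in> \<K>" "\<And>n. K n \<subseteq> A n" "measure M (\<Union>n. A n - K n) \<le> e"
      using pick[of A e] A AM \<open>0 < e\<close> by blast
    have "measure M ((\<Inter>n. A n) - (\<Inter>n. K n)) \<le> measure M (\<Union>n. A n - K n)"
      by (rule finite_measure_mono) (use AM KM K in auto)
    then have "measure M ((\<Inter>n. A n) - (\<Inter>n. K n)) \<le> e" using K(3) by linarith
    moreover have "(\<Inter>n. K n) \<subseteq> (\<Inter>n. A n)" using K(2) by blast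
    moreover have "(\<Inter>n. K n) \<in> \<K>" using Int[of K] K(1) by blast
    ultimately show "\<exists>K\<in>\<K>. K \<subseteq> (\<Inter>n. A n) \<and> measure M ((\<Inter>n. A n) - K) \<le> e" by blast
  qed
  have "inner A \<and> inner (space M - A)"
    using A unfolding gen
  proof (induction rule: sigma_sets.induct)
    case (Basic a)
    then show ?case using inner_gen inner_co by (simp add: inner_def)
  next
    case Empty
    have "inner {}" using empty by (auto simp: inner_def)
    moreover have "inner (space M)"
      unfolding inner_def
    proof (intro allI impI)
      fix e :: real assume "0 < e"
      then show "\<exists>K\<in>\<K>. K \<subseteq> space M \<and> measure M (space M - K) \<le> e"
        using inner_space[of e] sets.sets_into_space KM by blast
    qed
    ultimately show ?case by simp
  next
    case (Compl a)
    then have "a \<in> sets M" by (simp add: gen)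
    then have "space M - (space M - a) = a" using sets.sets_into_space by blast
    then show ?case using Compl by simp
  next
    case (Union a)
    have m: "a i \<in> sets M" for i using Union by (simp add: gen)
    have "space M - (\<Union>i. a i) = (\<Inter>i. space M - a i)" by auto
    then show ?case using inner_UN[of a] inner_INT[of "\<lambda>i. space M - a i"] Union.IH m by auto
  qed
  then show ?thesis using e by (simp add: inner_def)
qed

section \<open>Borel sets and compact approximation in a single Polish space\<close>

lemma space_borel_sets_of [simp]: "space (borel_sets_of T) = topspace T"
  by (simp add: borel_sets_of_def space_measure_of_conv)

lemma sets_borel_sets_of: "sets (borel_sets_of T) = sigma_sets (topspace T) {U. openin T U}"
  unfolding borel_sets_of_def by (rule sets_measure_of) (auto dest: openin_subset)

lemma openin_borel_sets_of: "openin T U \<Longrightarrow> U \<in> sets (borel_sets_of T)"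
  by (simp add: sets_borel_sets_of sigma_sets.Basic)

lemma closedin_borel_sets_of:
  assumes "closedin T C" shows "C \<in> sets (borel_sets_of T)"
proof -
  have "topspace T - (topspace T - C) = C" using closedin_subset[OF assms] by blast
  moreover have "topspace T - (topspace T - C) \<in> sets (borel_sets_of T)"
    using assms openin_borel_sets_of[of T "topspace T - C"]
      sets.compl_sets[of "topspace T - C" "borel_sets_of T"] by (simp add: closedin_def)
  ultimately show ?thesis by simp
qed

lemma polish_topologyD:
  assumes "polish_topology T"
  shows "metrizable_space T" "Hausdorff_space T"
  using assms
  by (auto simp: polish_topology_def completely_metrizable_imp_metrizable_space
      intro: metrizable_imp_Hausdorff_space)

lemma compactin_borel_sets_of:
  "polish_topology T \<Longrightarrow> compactin T K \<Longrightarrow> K \<in> sets (borel_sets_of T)"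
  by (meson closedin_borel_sets_of compactin_imp_closedin polish_topologyD(2))

text \<open>Ulam's theorem. For each radius, finitely many balls around points of a dense sequence
  carry all but a little mass. Intersecting these finite unions over all radii leaves a closed,
  totally bounded set, compact by completeness.\<close>

lemma polish_tight:
  assumes T: "polish_topology T" and "finite_measure \<mu>" and sets: "sets \<mu> = sets (borel_sets_of T)"
    and "0 < e"
  shows "\<exists>K. compactin T K \<and> measure \<mu> (topspace T - K) \<le> e"
proof -
  interpret finite_measure \<mu> by fact
  have sp: "space \<mu> = topspace T" using sets_eq_imp_space_eq[OF sets] by simp
  obtain M d where Md: "Metric_space M d" "Metric_space.mcomplete M d" "T = Metric_space.mtopology M d"
    using T by (auto simp: polish_topology_def completely_metrizable_space_def)
  interpret Metric_space M d by fact
  have top: "topspace T = M" by (simp add: Md(3))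
  have Ms: "M \<in> sets \<mu>" using sets.top[of \<mu>] sp top by simp
  obtain C where C: "countable C" "C \<subseteq> M" "T closure_of C = M"
    using T by (auto simp: polish_topology_def separable_space_def top)
  show ?thesis
  proof (cases "C = {}")
    case True
    then have "M = {}" using C by simp
    then show ?thesis using \<open>0 < e\<close> by (intro exI[of _ "{}"]) (simp add: top)
  next
    case False
    define c where "c = from_nat_into C"
    have cC: "range c = C" using False C(1) by (simp add: c_def)
    define L where "L m n = (\<Union>k\<le>n. mcball (c k) (1 / Suc m))" for m n :: nat
    have clL: "closedin T (L m n)" for m n
      by (auto simp: L_def Md(3) intro!: closedin_Union)
    then have Ls: "L m n \<in> sets \<mu>" for m n by (simp add: sets closedin_borel_sets_of)
    have "\<exists>n. measure \<mu> (M - L m n) \<le> e * (1/2) ^ Suc m" for m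
    proof -
      have inc: "incseq (L m)" unfolding incseq_def L_def by (intro allI impI UN_mono) auto
      have U: "(\<Union>n. L m n) = M"
      proof
        show "(\<Union>n. L m n) \<subseteq> M" by (auto simp: L_def)
        show "M \<subseteq> (\<Union>n. L m n)"
        proof
          fix x assume x: "x \<in> M"
          then have "x \<in> mtopology closure_of C" using C(3) Md(3) by simp
          then obtain y where y: "y \<in> C" "y \<in> mball x (1 / Suc m)"
            unfolding metric_closure_of using mem_Collect_eq by (auto simp del: of_nat_Suc in_mball) (meson of_nat_0_less_iff zero_less_Suc zero_less_divide_1_iff)
          then obtain k where "c k = y" using cC by blast
          then have "x \<in> mcball (c k) (1 / Suc m)"
            using y x C(2) by (auto simp: commute)
          then show "x \<in> (\<Union>n. L m n)" unfolding L_def by blast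
        qed
      qed
      have "(\<lambda>n. measure \<mu> (L m n)) \<longlonglongrightarrow> measure \<mu> M"
        using finite_Lim_measure_incseq[OF _ inc] Ls U by auto
      then have "eventually (\<lambda>n. measure \<mu> M - e * (1/2) ^ Suc m < measure \<mu> (L m n)) sequentially"
        by (rule order_tendstoD) (use \<open>0 < e\<close> in auto)
      then obtain n where n: "measure \<mu> M - e * (1/2) ^ Suc m < measure \<mu> (L m n)"
        by (auto simp: eventually_sequentially)
      have "measure \<mu> (M - L m n) = measure \<mu> M - measure \<mu> (L m n)"
        by (rule finite_measure_Diff) (use Ls U Ms in auto)
      then show ?thesis using n by (intro exI[of _ n]) linarith
    qed
    then obtain n where n: "\<And>m. measure \<mu> (M - L m (n m)) \<le> e * (1/2) ^ Suc m" by metis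
    define K where "K = (\<Inter>m. L m (n m))"
    have clK: "closedin T K" unfolding K_def by (rule closedin_Inter) (auto simp: clL)
    have "mtotally_bounded K"
      unfolding mtotally_bounded_absolute
    proof
      show KM: "K \<subseteq> M" using closedin_subset[OF clK] top by simp
      interpret S: Submetric M d K by unfold_locales (rule KM)
      show "S.sub.mtotally_bounded K"
        unfolding S.sub.mtotally_bounded_def
      proof (intro allI impI)
        fix r :: real assume "0 < r"
        \<comment> \<open>The centres \<open>c k\<close> need not lie in \<open>K\<close>. Moving
          each to a point of \<open>K\<close> in its ball doubles the radius, hence the factor
          2.\<close>
        obtain m :: nat where m: "1 / Suc m < r / 2"
          using reals_Archimedean[of "r/2"] \<open>0 < r\<close> by (auto simp: inverse_eq_divide)
        define pick where "pick k = (SOME x. x \<in> K \<inter> mcball (c k) (1 / Suc m))" for k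
        define J where "J = {k. k \<le> n m \<and> K \<inter> mcball (c k) (1 / Suc m) \<noteq> {}}"
        have pk: "pick k \<in> K \<inter> mcball (c k) (1 / Suc m)" if "k \<in> J" for k
          unfolding pick_def by (rule someI_ex) (use that in \<open>auto simp: J_def\<close>)
        have "K \<subseteq> (\<Union>x\<in>pick ` J. S.sub.mball x r)"
        proof
          fix x assume x: "x \<in> K"
          then have "x \<in> L m (n m)" by (auto simp: K_def)
          then obtain k where k: "k \<le> n m" "x \<in> mcball (c k) (1 / Suc m)" by (auto simp: L_def)
          then have kJ: "k \<in> J" using x by (auto simp: J_def)
          have "d (pick k) x \<le> d (pick k) (c k) + d (c k) x"
            by (rule triangle) (use pk[OF kJ] k in auto)
          also have "\<dots> < r" using pk[OF kJ] k m by (auto simp: commute)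
          finally have "x \<in> S.sub.mball (pick k) r" using pk[OF kJ] x by auto
          then show "x \<in> (\<Union>x\<in>pick ` J. S.sub.mball x r)" using kJ by blast
        qed
        moreover have "finite (pick ` J)" by (simp add: J_def)
        moreover have "pick ` J \<subseteq> K" using pk by auto
        ultimately show "\<exists>F. finite F \<and> F \<subseteq> K \<and> K \<subseteq> (\<Union>x\<in>F. S.sub.mball x r)" by blast
      qed
    qed
    then have "compactin T (T closure_of K)"
      using mtotally_bounded_eq_compact_closure_of[OF Md(2)] by (simp add: Md(3))
    then have "compactin T K" using clK by (simp add: closure_of_closedin)
    moreover have "measure \<mu> (M - K) \<le> e"
    proof -
      have s: "(\<lambda>n. e * (1/2) ^ Suc n) sums e"
        using sums_mult[OF power_half_series, of e] by simp
      have sm: "summable (\<lambda>m. measure \<mu> (M - L m (n m)))"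
        by (rule summable_comparison_test'[OF sums_summable[OF s], of 0]) (use n in auto)
      have "M - K = (\<Union>m. M - L m (n m))" by (auto simp: K_def)
      also have "measure \<mu> \<dots> \<le> (\<Sum>m. measure \<mu> (M - L m (n m)))"
        by (rule finite_measure_subadditive_countably)
          (use Ls sm Ms in auto)
      also have "\<dots> \<le> (\<Sum>n. e * (1/2) ^ Suc n)"
        by (rule suminf_le[OF n sm sums_summable[OF s]])
      also have "\<dots> = e" using s by (simp add: sums_iff)
      finally show ?thesis .
    qed
    ultimately show ?thesis by (auto simp: top)
  qed
qed

text \<open>Open sets generate, so only open and closed sets have to be approximated. A closed set
  is intersected with a compact set from tightness; an open set is an increasing union of closed
  ones, by metrizability.\<close>

lemma polish_inner_regular:
  assumes T: "polish_topology T" and "finite_measure \<mu>" and sets: "sets \<mu> = sets (borel_sets_of T)"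
    and A: "A \<in> sets \<mu>" and e: "0 < e"
  shows "\<exists>K. compactin T K \<and> K \<subseteq> A \<and> measure \<mu> (A - K) \<le> e"
proof -
  interpret finite_measure \<mu> by fact
  have sp: "space \<mu> = topspace T" using sets_eq_imp_space_eq[OF sets] by simp
  have top: "topspace T \<in> sets \<mu>" using sets.top[of \<mu>] sp by simp
  note haus = polish_topologyD(2)[OF T]
  have closed_inner: "\<exists>K\<in>{K. compactin T K}. K \<subseteq> C \<and> measure \<mu> (C - K) \<le> e"
    if C: "closedin T C" and "0 < e" for C and e :: real
  proof -
    obtain K where K: "compactin T K" "measure \<mu> (topspace T - K) \<le> e"
      using polish_tight[OF T \<open>finite_measure \<mu>\<close> sets \<open>0 < e\<close>] by blast
    have "measure \<mu> (C - (C \<inter> K)) \<le> measure \<mu> (topspace T - K)"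
      by (rule finite_measure_mono)
        (use closedin_subset[OF C] compactin_borel_sets_of[OF T K(1)] top
         in \<open>auto simp: sets\<close>)
    then show ?thesis
      using K closed_Int_compactin[OF C K(1)] by (intro bexI[of _ "C \<inter> K"]) auto
  qed
  have "\<exists>K\<in>{K. compactin T K}. K \<subseteq> A \<and> measure \<mu> (A - K) \<le> e"
  proof (rule inner_regular_sigma_sets[where G = "{U. openin T U}", OF _ _ _ _ _ _ _ _ A e])
    show "sets \<mu> = sigma_sets (space \<mu>) {U. openin T U}" by (simp add: sets sets_borel_sets_of sp)
    show "{K. compactin T K} \<subseteq> sets \<mu>" using compactin_borel_sets_of[OF T] sets by auto
    show "(\<Inter>n. K n) \<in> {K. compactin T K}" if "range K \<subseteq> {K. compactin T K}" for K :: "nat \<Rightarrow> _"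
      using that closed_compactin_Inter[of T "K 0" "range K"] compactin_imp_closedin[OF haus] by auto
    show "\<exists>K\<in>{K. compactin T K}. measure \<mu> (space \<mu> - K) \<le> e" if "0 < e" for e
      using polish_tight[OF T \<open>finite_measure \<mu>\<close> sets that] by (auto simp: sp)
    show "\<exists>K\<in>{K. compactin T K}. K \<subseteq> space \<mu> - U \<and> measure \<mu> (space \<mu> - U - K) \<le> e"
      if "U \<in> {U. openin T U}" "0 < e" for U e
      using closed_inner[of "topspace T - U" e] that by (simp add: sp closedin_diff)
    show "\<exists>K\<in>{K. compactin T K}. K \<subseteq> U \<and> measure \<mu> (U - K) \<le> e"
      if U: "U \<in> {U. openin T U}" and "0 < e" for U and e :: real
    proof -
      have "fsigma_in T U" using U polish_topologyD(1)[OF T] by (simp add: open_imp_fsigma_in)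
      then obtain C :: "nat \<Rightarrow> _" where C: "\<And>n. closedin T (C n)" "\<And>n. C n \<subseteq> C (Suc n)" "\<Union>(range C) = U"
        by (auto simp: fsigma_in_ascending)
      have Cs: "C n \<in> sets \<mu>" for n using C(1) sets by (simp add: closedin_borel_sets_of)
      have "(\<lambda>n. measure \<mu> (C n)) \<longlonglongrightarrow> measure \<mu> U"
        using finite_Lim_measure_incseq[of C] C Cs by (auto simp: incseq_Suc_iff)
      then have "eventually (\<lambda>n. measure \<mu> U - e/2 < measure \<mu> (C n)) sequentially"
        by (rule order_tendstoD) (use \<open>0 < e\<close> in auto)
      then obtain n where n: "measure \<mu> U - e/2 < measure \<mu> (C n)"
        by (auto simp: eventually_sequentially)
      obtain K where K: "compactin T K" "K \<subseteq> C n" "measure \<mu> (C n - K) \<le> e/2"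
        using closed_inner[OF C(1)[of n], of "e/2"] \<open>0 < e\<close> by auto
      have Us: "U \<in> sets \<mu>" using U by (simp add: sets openin_borel_sets_of)
      have Ks: "K \<in> sets \<mu>" using K sets compactin_borel_sets_of[OF T] by auto
      have "C n \<subseteq> U" using C(3) by blast
      have "measure \<mu> (U - K) = measure \<mu> U - measure \<mu> K"
        by (rule finite_measure_Diff) (use Us Ks K \<open>C n \<subseteq> U\<close> in auto)
      moreover have "measure \<mu> (C n - K) = measure \<mu> (C n) - measure \<mu> K"
        by (rule finite_measure_Diff) (use Cs Ks K in auto)
      ultimately have "measure \<mu> (U - K) \<le> e" using n K(3) by linarith
      then show ?thesis using K \<open>C n \<subseteq> U\<close> by auto
    qed
  qed (auto intro: compactin_Un)
  then show ?thesis by auto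
qed


section \<open>Compact approximation in finite products\<close>

lemma sets_PiM_borel_sets_of_single:
  "i \<in> I \<Longrightarrow> A \<in> sets (borel_sets_of (T i)) \<Longrightarrow>
     {w \<in> (\<Pi>\<^sub>E i\<in>I. topspace (T i)). w i \<in> A} \<in> sets (\<Pi>\<^sub>M i\<in>I. borel_sets_of (T i))"
  using measurable_sets[OF measurable_component_singleton[of i I "\<lambda>i. borel_sets_of (T i)"], of A]
  by (auto simp: space_PiM vimage_def Int_def conj_commute)

text \<open>Cylinders over one coordinate generate and are closed under complement; each is filled
  by a box of compact sets chosen for the marginals. Measurability of \<open>K\<close> is part of
  the approximating class, which spares a comparison of the product sigma-algebra with the Borel
  sets of the product topology.\<close>

lemma polish_product_inner_regular:
  fixes T :: "'i \<Rightarrow> 'a topology"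
  assumes I: "finite I" and T: "\<And>i. i \<in> I \<Longrightarrow> polish_topology (T i)"
    and "prob_space \<mu>" and sets: "sets \<mu> = sets (\<Pi>\<^sub>M i\<in>I. borel_sets_of (T i))"
    and A: "A \<in> sets \<mu>" and e: "0 < e"
  shows "\<exists>K. compactin (product_topology T I) K \<and> K \<in> sets \<mu> \<and> K \<subseteq> A \<and> measure \<mu> (A - K) \<le> e"
proof -
  interpret prob_space \<mu> by fact
  let ?M = "\<Pi>\<^sub>M i\<in>I. borel_sets_of (T i)"
  have sp: "space \<mu> = (\<Pi>\<^sub>E i\<in>I. topspace (T i))"
    using sets_eq_imp_space_eq[OF sets] by (simp add: space_PiM)
  have haus: "Hausdorff_space (product_topology T I)"
    using T polish_topologyD(2) by (auto simp: Hausdorff_space_product_topology)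
  let ?K = "{K. compactin (product_topology T I) K \<and> K \<in> sets \<mu>}"
  let ?\<mu> = "\<lambda>i. distr \<mu> (borel_sets_of (T i)) (\<lambda>w. w i)"
  have meas: "(\<lambda>w. w i) \<in> measurable \<mu> (borel_sets_of (T i))" if "i \<in> I" for i
    using measurable_component_singleton[OF that] by (simp add: measurable_cong_sets[OF sets refl])
  have fin: "finite_measure (?\<mu> i)" if "i \<in> I" for i
    using prob_space_distr[OF meas[OF that]] by (simp add: prob_space_def)
  have single: "{w \<in> space \<mu>. w i \<in> B} \<in> sets \<mu>" if "i \<in> I" "B \<in> sets (borel_sets_of (T i))" for i B
    using sets_PiM_borel_sets_of_single[of i I B T] that by (simp add: sets sp)
  have box: "\<exists>K\<in>?K. K \<subseteq> {w \<in> space \<mu>. w i \<in> B} \<and> measure \<mu> ({w \<in> space \<mu>. w i \<in> B} - K) \<le> e"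
    if i: "i \<in> I" and B: "B \<in> sets (borel_sets_of (T i))" and e: "0 < e" for i B and e :: real
  proof -
    \<comment> \<open>A point of the cylinder outside the box fails in one of \<open>card I\<close>
      coordinates, and each failure has mass at most \<open>d\<close>.\<close>
    define d where "d = e / card I"
    have card: "0 < card I" using i I by (auto simp: card_gt_0_iff)
    then have d: "0 < d" using e by (simp add: d_def)
    define BB where "BB j = (if j = i then B else topspace (T j))" for j
    have BBs: "BB j \<in> sets (borel_sets_of (T j))" if "j \<in> I" for j
      using B sets.top[of "borel_sets_of (T j)"] by (auto simp: BB_def)
    have "\<forall>j\<in>I. \<exists>K. compactin (T j) K \<and> K \<subseteq> BB j \<and> measure (?\<mu> j) (BB j - K) \<le> d"
      using polish_inner_regular[OF T fin] BBs d by simp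
    then obtain K where K: "\<And>j. j \<in> I \<Longrightarrow> compactin (T j) (K j)" "\<And>j. j \<in> I \<Longrightarrow> K j \<subseteq> BB j"
      "\<And>j. j \<in> I \<Longrightarrow> measure (?\<mu> j) (BB j - K j) \<le> d"
      by metis
    have Ks: "j \<in> I \<Longrightarrow> K j \<in> sets (borel_sets_of (T j))" for j
      using K(1) T compactin_borel_sets_of by blast
    have PK: "Pi\<^sub>E I K \<in> sets \<mu>" unfolding sets by (rule sets_PiM_I_finite) (use I Ks in auto)
    have "compactin (product_topology T I) (Pi\<^sub>E I K)" using K(1) by (auto simp: compactin_PiE)
    moreover have "Pi\<^sub>E I K \<subseteq> {w \<in> space \<mu>. w i \<in> B}"
      using K(2) i sets.sets_into_space[OF BBs] by (fastforce simp: sp PiE_iff BB_def)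
    moreover have "measure \<mu> ({w \<in> space \<mu>. w i \<in> B} - Pi\<^sub>E I K) \<le> e"
    proof -
      have "{w \<in> space \<mu>. w i \<in> B} - Pi\<^sub>E I K \<subseteq> (\<Union>j\<in>I. {w \<in> space \<mu>. w j \<in> BB j - K j})"
        by (auto simp: sp PiE_iff BB_def extensional_def split: if_splits)
      then have "measure \<mu> ({w \<in> space \<mu>. w i \<in> B} - Pi\<^sub>E I K)
          \<le> measure \<mu> (\<Union>j\<in>I. {w \<in> space \<mu>. w j \<in> BB j - K j})"
        by (rule finite_measure_mono) (use single BBs Ks I in auto)
      also have "\<dots> \<le> (\<Sum>j\<in>I. measure \<mu> {w \<in> space \<mu>. w j \<in> BB j - K j})"
        by (rule finite_measure_subadditive_finite) (use single BBs Ks I in auto)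
      also have "\<dots> \<le> (\<Sum>j\<in>I. d)"
      proof (rule sum_mono)
        fix j assume j: "j \<in> I"
        have "measure (?\<mu> j) (BB j - K j) = measure \<mu> {w \<in> space \<mu>. w j \<in> BB j - K j}"
          using measure_distr[OF meas[OF j], of "BB j - K j"] BBs[OF j] Ks[OF j]
          by (simp add: vimage_def Int_def conj_commute)
        then show "measure \<mu> {w \<in> space \<mu>. w j \<in> BB j - K j} \<le> d" using K(3)[OF j] by simp
      qed
      also have "\<dots> = e" using card by (simp add: d_def)
      finally show ?thesis .
    qed
    ultimately show ?thesis using PK by blast
  qed
  define G where "G = {{f \<in> \<Pi>\<^sub>E i\<in>I. topspace (T i). f i \<in> A} | i A. i \<in> I \<and> A \<in> sets (borel_sets_of (T i))}"
  have "\<exists>K\<in>?K. K \<subseteq> A \<and> measure \<mu> (A - K) \<le> e"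
  proof (rule inner_regular_sigma_sets[where G = G, OF _ _ _ _ _ _ _ _ A e])
    show "sets \<mu> = sigma_sets (space \<mu>) G" unfolding sets sp G_def by (simp add: sets_PiM_single)
    show "(\<Inter>n. K n) \<in> ?K" if "range K \<subseteq> ?K" for K :: "nat \<Rightarrow> _"
    proof -
      have "compactin (product_topology T I) (\<Inter>n. K n)"
        using that closed_compactin_Inter[of "product_topology T I" "K 0" "range K"]
          compactin_imp_closedin[OF haus] by auto
      moreover have "(\<Inter>n. K n) \<in> sets \<mu>"
        by (rule sets.countable_INT) (use that in auto)
      ultimately show ?thesis by simp
    qed
    show "\<exists>K\<in>?K. K \<subseteq> B \<and> measure \<mu> (B - K) \<le> e" if "B \<in> G" "0 < e" for B e
      using that box by (auto simp: G_def sp)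
    show "\<exists>K\<in>?K. K \<subseteq> space \<mu> - B \<and> measure \<mu> (space \<mu> - B - K) \<le> e" if "B \<in> G" "0 < e" for B e
    proof -
      obtain i C where iC: "i \<in> I" "C \<in> sets (borel_sets_of (T i))" "B = {w \<in> space \<mu>. w i \<in> C}"
        using \<open>B \<in> G\<close> by (auto simp: G_def sp)
      have "space \<mu> - B = {w \<in> space \<mu>. w i \<in> topspace (T i) - C}"
        using iC(1) by (auto simp: sp iC(3))
      then show ?thesis
        using box[OF iC(1) _ \<open>0 < e\<close>, of "topspace (T i) - C"]
          sets.compl_sets[OF iC(2)] by simp
    qed
    show "\<exists>K\<in>?K. measure \<mu> (space \<mu> - K) \<le> e" if "0 < e" for e
    proof (cases "I = {}")
      \<comment> \<open>With no coordinate there is no cylinder for \<open>box\<close>, but the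
        product is then a single point.\<close>
      case True
      then have "space \<mu> \<in> ?K"
        using sets.top[of \<mu>] by (auto simp: sp finite_imp_compactin)
      then show ?thesis using \<open>0 < e\<close> by (intro bexI[of _ "space \<mu>"]) auto
    next
      case False
      then obtain i where i: "i \<in> I" by blast
      then have "{w \<in> space \<mu>. w i \<in> topspace (T i)} = space \<mu>" by (auto simp: sp)
      then show ?thesis
        using box[OF i _ \<open>0 < e\<close>, of "topspace (T i)"] sets.top[of "borel_sets_of (T i)"] by auto
    qed
  qed (auto intro: compactin_Un)
  then show ?thesis by auto
qed

section \<open>Integrals against measures with close marginals\<close>

text \<open>Tonelli, with \<open>h x\<close> written as the length of \<open>{0..<h x}\<close>.
  \<open>ennreal\<close> cuts off negative values, which matches the restriction to
  \<open>0 \<le> s\<close>.\<close>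

lemma (in sigma_finite_measure) nn_integral_layer_cake:
  fixes h :: "'a \<Rightarrow> real"
  assumes [measurable]: "h \<in> borel_measurable M"
  shows "(\<integral>\<^sup>+x. ennreal (h x) \<partial>M)
       = (\<integral>\<^sup>+s. emeasure M {x \<in> space M. s < h x} * indicator {0..} s \<partial>lborel)"
proof -
  interpret pair_sigma_finite M lborel ..
  have "(\<integral>\<^sup>+x. ennreal (h x) \<partial>M) = (\<integral>\<^sup>+x. \<integral>\<^sup>+s. indicator {0..} s * indicator {..<h x} s \<partial>lborel \<partial>M)"
  proof (rule nn_integral_cong)
    fix x
    have "(\<integral>\<^sup>+s. indicator {0..} s * indicator {..<h x} s \<partial>lborel) = (\<integral>\<^sup>+s. indicator {0..<h x} s \<partial>lborel)"
      by (rule nn_integral_cong) (auto simp: indicator_def)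
    also have "\<dots> = ennreal (h x)"
      by (cases "0 \<le> h x") (auto simp: ennreal_neg)
    finally show "ennreal (h x) = (\<integral>\<^sup>+s. indicator {0..} s * indicator {..<h x} s \<partial>lborel)" ..
  qed
  also have "\<dots> = (\<integral>\<^sup>+s. \<integral>\<^sup>+x. indicator {0..} s * indicator {..<h x} s \<partial>M \<partial>lborel)"
    by (rule Fubini'[symmetric]) (simp add: split_beta', measurable, subst lessThan_iff, measurable)
  also have "\<dots> = (\<integral>\<^sup>+s. emeasure M {x \<in> space M. s < h x} * indicator {0..} s \<partial>lborel)"
  proof (rule nn_integral_cong)
    fix s :: real
    have "(\<integral>\<^sup>+x. indicator {0..} s * indicator {..<h x} s \<partial>M)
        = (\<integral>\<^sup>+x. indicator {0..} s * indicator {x \<in> space M. s < h x} x \<partial>M)"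
      by (rule nn_integral_cong) (auto simp: indicator_def)
    then show "(\<integral>\<^sup>+x. indicator {0..} s * indicator {..<h x} s \<partial>M)
        = emeasure M {x \<in> space M. s < h x} * indicator {0..} s"
      by (simp add: nn_integral_cmult mult.commute)
  qed
  finally show ?thesis .
qed

text \<open>A coupling would make the \<open>b\<close>-coordinates agree up to probability
  \<epsilon>, at cost \<open>C\<close> when they agree and a further \<open>B\<close> otherwise.
  Here tails are compared instead: raising the threshold by \<open>C\<close> absorbs the other
  coordinates, and the error \<epsilon> is integrated over thresholds in an interval of length
  \<open>B\<close>.\<close>

lemma integral_le_of_marginal_tv:
  fixes T :: "'i \<Rightarrow> 'a topology" and G :: "('i \<Rightarrow> 'a) \<Rightarrow> real"
  assumes I: "finite I" and T: "\<And>i. i \<in> I \<Longrightarrow> polish_topology (T i)"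
    and mu: "prob_space \<mu>" "sets \<mu> = sets (\<Pi>\<^sub>M i\<in>I. borel_sets_of (T i))"
    and nu: "prob_space \<nu>" "sets \<nu> = sets (\<Pi>\<^sub>M i\<in>I. borel_sets_of (T i))"
    and b: "b \<in> I"
    and tv: "\<And>D. D \<in> sets (borel_sets_of (T b)) \<Longrightarrow>
           measure \<mu> {w \<in> space \<mu>. w b \<in> D} \<le> measure \<nu> {w \<in> space \<nu>. w b \<in> D} + \<epsilon>"
    and G: "G \<in> borel_measurable (\<Pi>\<^sub>M i\<in>I. borel_sets_of (T i))"
    and osc: "\<And>w w'. w \<in> space \<mu> \<Longrightarrow> w' \<in> space \<mu> \<Longrightarrow> G w - G w' \<le> C + B * of_bool (w b \<noteq> w' b)"
    and nonneg: "0 \<le> C" "0 \<le> B" "0 \<le> \<epsilon>"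
  shows "integral\<^sup>L \<mu> G \<le> integral\<^sup>L \<nu> G + C + \<epsilon> * B"
proof -
  interpret mu: prob_space \<mu> by fact
  interpret nu: prob_space \<nu> by fact
  have sp: "space \<mu> = (\<Pi>\<^sub>E i\<in>I. topspace (T i))" "space \<nu> = space \<mu>"
    using sets_eq_imp_space_eq[OF mu(2)] sets_eq_imp_space_eq[OF nu(2)] by (simp_all add: space_PiM)
  have Gm[measurable]: "G \<in> borel_measurable \<mu>" "G \<in> borel_measurable \<nu>"
    using G by (simp_all add: measurable_cong_sets[OF mu(2) refl] measurable_cong_sets[OF nu(2) refl])
  text \<open>Values of \<open>b\<close>-coordinates met by a compact part of \<open>{G > s + C}\<close> form a closed set, and
    \<open>G > s\<close> over that set.\<close>
  have tail: "measure \<mu> {w \<in> space \<mu>. s + C < G w} \<le> measure \<nu> {w \<in> space \<nu>. s < G w} + \<epsilon>" for s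
  proof (rule field_le_epsilon)
    fix e :: real assume "0 < e"
    let ?A = "{w \<in> space \<mu>. s + C < G w}"
    have As: "?A \<in> sets \<mu>" by measurable
    obtain K where K: "compactin (product_topology T I) K" "K \<in> sets \<mu>" "K \<subseteq> ?A" "measure \<mu> (?A - K) \<le> e"
      using polish_product_inner_regular[OF I T mu As \<open>0 < e\<close>] by blast
    \<comment> \<open>The projection of a merely measurable set may fail to be Borel, which would
      put \<open>tv\<close> out of reach; compactness survives projection.\<close>
    define D where "D = (\<lambda>w. w b) ` K"
    have "compactin (T b) D"
      unfolding D_def by (rule image_compactin[OF K(1)]) (rule continuous_map_product_projection[OF b])
    then have D: "D \<in> sets (borel_sets_of (T b))" using T[OF b] by (simp add: compactin_borel_sets_of)
    have Dm: "{w \<in> space \<mu>. w b \<in> D} \<in> sets \<mu>"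
      using sets_PiM_borel_sets_of_single[of b I D T] b D by (simp add: mu(2) sp)
    have "measure \<mu> ?A = measure \<mu> K + measure \<mu> (?A - K)"
      using mu.finite_measure_Diff[OF As K(2,3)] by simp
    also have "measure \<mu> K \<le> measure \<mu> {w \<in> space \<mu>. w b \<in> D}"
      by (rule mu.finite_measure_mono[OF _ Dm]) (use K(3) in \<open>auto simp: D_def\<close>)
    also have "\<dots> \<le> measure \<nu> {w \<in> space \<nu>. w b \<in> D} + \<epsilon>" by (rule tv[OF D])
    also have "measure \<nu> {w \<in> space \<nu>. w b \<in> D} \<le> measure \<nu> {w \<in> space \<nu>. s < G w}"
    proof (rule nu.finite_measure_mono)
      show "{w \<in> space \<nu>. w b \<in> D} \<subseteq> {w \<in> space \<nu>. s < G w}"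
      proof safe
        fix w assume w: "w \<in> space \<nu>" "w b \<in> D"
        then obtain k where k: "k \<in> K" "w b = k b" by (auto simp: D_def)
        have "k \<in> space \<mu>" "s + C < G k" using K(3) k(1) by auto
        then show "s < G w" using osc[of k w] w sp k(2) by simp
      qed
    qed measurable
    finally show "measure \<mu> ?A \<le> measure \<nu> {w \<in> space \<nu>. s < G w} + \<epsilon> + e" using K(4) by linarith
  qed
  obtain w0 where w0: "w0 \<in> space \<mu>" using mu.not_empty by blast
  have bdd: "\<bar>G w - G w0\<bar> \<le> C + B" if "w \<in> space \<mu>" for w
    using osc[OF that w0] osc[OF w0 that] nonneg(2) by (auto simp: of_bool_def split: if_splits)
  define m where "m = (INF w\<in>space \<mu>. G w)"
  have m_le: "m \<le> G w" if "w \<in> space \<mu>" for w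
    unfolding m_def
    by (rule cINF_lower[OF _ that], rule bdd_belowI2[of _ "G w0 - (C + B)"]) (use bdd in force)
  have le_m: "G w \<le> m + (C + B)" if "w \<in> space \<mu>" for w
  proof -
    have "G w - (C + B) \<le> m"
      unfolding m_def
    proof (rule cINF_greatest)
      fix w' assume "w' \<in> space \<mu>"
      then show "G w - (C + B) \<le> G w'"
        using osc[OF that, of w'] nonneg(2) by (auto simp: of_bool_def split: if_splits)
    qed (use mu.not_empty in auto)
    then show ?thesis by simp
  qed
  have G_le: "\<bar>G w\<bar> \<le> \<bar>G w0\<bar> + (C + B)" if "w \<in> space \<mu>" for w using bdd[OF that] by linarith
  have G_int: "integrable \<mu> G" "integrable \<nu> G"
    using mu.integrable_const_bound[of G "\<bar>G w0\<bar> + (C + B)"]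
      nu.integrable_const_bound[of G "\<bar>G w0\<bar> + (C + B)"] G_le
      AE_I2[of \<nu> "\<lambda>w. \<bar>G w\<bar> \<le> \<bar>G w0\<bar> + (C + B)"] by (auto simp: sp(2))
  \<comment> \<open>\<open>H\<close> is the part of \<open>G\<close> above \<open>m + C\<close>. Its
    values lie in \<open>{0..B}\<close>, so its tails vanish beyond \<open>B\<close>; for
    \<open>0 \<le> s\<close> its tail at \<open>s\<close> is that of \<open>G\<close> at
    \<open>m + s + C\<close>, where \<open>tail\<close> applies.\<close>
  define H where "H w = max 0 (G w - m - C)" for w
  have H: "H w \<le> B" "0 \<le> H w" if "w \<in> space \<mu>" for w using le_m[OF that] nonneg by (auto simp: H_def)
  have Hm[measurable]: "H \<in> borel_measurable \<mu>" unfolding H_def by measurable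
  have H_int: "integrable \<mu> H"
    by (rule mu.integrable_const_bound[where B = B]) (auto intro!: AE_I2 simp: H)
  have nuG: "nn_integral \<nu> (\<lambda>w. ennreal (G w - m)) = ennreal (integral\<^sup>L \<nu> G - m)"
    using G_int m_le nu.prob_space
    by (subst nn_integral_eq_integral) (auto simp: sp(2) intro!: AE_I2)
  have "ennreal (integral\<^sup>L \<mu> H) = (\<integral>\<^sup>+w. ennreal (H w) \<partial>\<mu>)"
    by (rule nn_integral_eq_integral[symmetric]) (auto intro!: AE_I2 simp: H H_int)
  also have "\<dots> = (\<integral>\<^sup>+s. emeasure \<mu> {w \<in> space \<mu>. s < H w} * indicator {0..} s \<partial>lborel)"
    by (rule mu.nn_integral_layer_cake) measurable
  also have "\<dots> \<le> (\<integral>\<^sup>+s. emeasure \<nu> {w \<in> space \<nu>. s < G w - m} * indicator {0..} s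
                     + ennreal \<epsilon> * indicator {0..B} s \<partial>lborel)"
  proof (rule nn_integral_mono)
    fix s :: real
    consider "s < 0" | "B < s" | "0 \<le> s" "s \<le> B" by linarith
    then show "emeasure \<mu> {w \<in> space \<mu>. s < H w} * indicator {0..} s
        \<le> emeasure \<nu> {w \<in> space \<nu>. s < G w - m} * indicator {0..} s + ennreal \<epsilon> * indicator {0..B} s"
    proof cases
      case 2
      then have "{w \<in> space \<mu>. s < H w} = {}" using H by force
      then show ?thesis by (simp only: emeasure_empty) simp
    next
      case 3
      have "{w \<in> space \<mu>. s < H w} = {w \<in> space \<mu>. (m + s) + C < G w}"
        using 3 by (auto simp: H_def)
      moreover have "{w \<in> space \<nu>. s < G w - m} = {w \<in> space \<nu>. m + s < G w}" by auto
      ultimately show ?thesis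
        using tail[of "m + s"] 3 nonneg
        by (simp add: mu.emeasure_eq_measure nu.emeasure_eq_measure flip: ennreal_plus)
    qed auto
  qed
  also have "\<dots> = (\<integral>\<^sup>+s. emeasure \<nu> {w \<in> space \<nu>. s < G w - m} * indicator {0..} s \<partial>lborel)
      + (\<integral>\<^sup>+s. ennreal \<epsilon> * indicator {0..B} s \<partial>lborel)"
  proof (rule nn_integral_add)
    have "(\<lambda>s. emeasure \<nu> {w \<in> space \<nu>. s < G w - m}) \<in> borel_measurable lborel"
      by (rule nu.measurable_emeasure) measurable
    then show "(\<lambda>s. emeasure \<nu> {w \<in> space \<nu>. s < G w - m} * indicator {0..} s) \<in> borel_measurable lborel"
      by measurable
  qed measurable
  also have "(\<integral>\<^sup>+s. emeasure \<nu> {w \<in> space \<nu>. s < G w - m} * indicator {0..} s \<partial>lborel)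
      = ennreal (integral\<^sup>L \<nu> G - m)"
    unfolding nuG[symmetric] by (rule nu.nn_integral_layer_cake[symmetric]) measurable
  also have "(\<integral>\<^sup>+s. ennreal \<epsilon> * indicator {0..B} s \<partial>lborel) = ennreal (\<epsilon> * B)"
    using nonneg by (simp add: nn_integral_cmult ennreal_mult)
  finally have HG: "integral\<^sup>L \<mu> H \<le> integral\<^sup>L \<nu> G - m + \<epsilon> * B"
  proof -
    assume "ennreal (integral\<^sup>L \<mu> H) \<le> ennreal (integral\<^sup>L \<nu> G - m) + ennreal (\<epsilon> * B)"
    moreover have "0 \<le> integral\<^sup>L \<nu> G - m"
      using nu.integral_ge_const[OF G_int(2) AE_I2, of m] m_le by (simp add: sp(2))
    ultimately show ?thesis
      using nonneg by (simp flip: ennreal_plus)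
  qed
  have "integral\<^sup>L \<mu> G \<le> integral\<^sup>L \<mu> (\<lambda>w. m + C + H w)"
    by (rule integral_mono) (use G_int H_int in \<open>auto simp: H_def\<close>)
  also have "\<dots> = m + C + integral\<^sup>L \<mu> H" using H_int by (simp add: mu.prob_space)
  finally show ?thesis using HG by linarith
qed

section \<open>Path laws generated by transition kernels\<close>

text \<open>The path up to time \<open>0\<close> is empty, so the initial law \<open>\<nu>\<close> acts as the kernel at time \<open>0\<close>.\<close>

locale markov_kernels =
  fixes N :: nat and T :: "nat \<Rightarrow> 'a topology" and K :: "nat \<Rightarrow> 'a \<Rightarrow> 'a measure" and \<nu> :: "'a measure"
  assumes nu: "0 < N \<Longrightarrow> \<nu> \<in> space (prob_algebra (borel_sets_of (T 1)))"
    and K: "\<And>i. 1 \<le> i \<Longrightarrow> i < N \<Longrightarrow>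
      K i \<in> measurable (borel_sets_of (T i)) (prob_algebra (borel_sets_of (T (Suc i))))"
begin

definition Q :: "nat \<Rightarrow> (nat \<Rightarrow> 'a) \<Rightarrow> 'a measure" where
  "Q i x = (if i = 0 then \<nu> else K i (x i))"

definition step :: "nat \<Rightarrow> (nat \<Rightarrow> 'a) \<Rightarrow> (nat \<Rightarrow> 'a) measure" where
  "step i x = distr (Q i x) (path_space T (Suc i)) (\<lambda>z. x(Suc i := z))"

text \<open>\<open>traj a m x\<close> is the law of the path up to time \<open>a + m\<close>, given that it is \<open>x\<close> up to time \<open>a\<close>.\<close>

primrec traj :: "nat \<Rightarrow> nat \<Rightarrow> (nat \<Rightarrow> 'a) \<Rightarrow> (nat \<Rightarrow> 'a) measure" where
  "traj a 0 = return (path_space T a)"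
| "traj a (Suc m) = (\<lambda>x. traj a m x \<bind> step (a + m))"

lemma space_path_space: "space (path_space T i) = (\<Pi>\<^sub>E j\<in>{1..i}. space (borel_sets_of (T j)))"
  by (simp add: path_space_def space_PiM)

lemma measurable_path_coord:
  "j \<in> {1..i} \<Longrightarrow> (\<lambda>x. x j) \<in> measurable (path_space T i) (borel_sets_of (T j))"
  unfolding path_space_def by (rule measurable_component_singleton)

lemma measurable_Q:
  assumes "i < N" shows "Q i \<in> measurable (path_space T i) (prob_algebra (borel_sets_of (T (Suc i))))"
proof (cases "i = 0")
  case True
  then show ?thesis using nu assms by (simp add: Q_def[abs_def])
next
  case False
  then have "(\<lambda>x. K i (x i)) \<in> measurable (path_space T i) (prob_algebra (borel_sets_of (T (Suc i))))"
    using assms by (intro measurable_compose[OF measurable_path_coord K]) auto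
  then show ?thesis using False by (simp add: Q_def[abs_def])
qed

lemma measurable_extend_path:
  "(\<lambda>(x, z). x(Suc i := z)) \<in> measurable (path_space T i \<Otimes>\<^sub>M borel_sets_of (T (Suc i))) (path_space T (Suc i))"
  using measurable_add_dim[of "Suc i" "{1..i}" "\<lambda>i. borel_sets_of (T i)"]
  by (simp add: path_space_def atLeastAtMostSuc_conv)

lemma measurable_extend_Q:
  assumes "i < N" "x \<in> space (path_space T i)"
  shows "(\<lambda>z. x(Suc i := z)) \<in> measurable (Q i x) (path_space T (Suc i))"
proof -
  have "sets (Q i x) = sets (borel_sets_of (T (Suc i)))"
    using measurable_space[OF measurable_Q[OF assms(1)] assms(2)] by (simp add: space_prob_algebra)
  then show ?thesis
    unfolding measurable_cong_sets[OF \<open>sets (Q i x) = _\<close> refl]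
    using measurable_compose[OF measurable_Pair1'[OF assms(2)] measurable_extend_path] by simp
qed

lemma measurable_step:
  "i < N \<Longrightarrow> step i \<in> measurable (path_space T i) (prob_algebra (path_space T (Suc i)))"
  unfolding step_def[abs_def]
  by (rule measurable_distr_prob_space2[OF measurable_Q measurable_extend_path])

lemma measurable_traj:
  "a + m \<le> N \<Longrightarrow> traj a m \<in> measurable (path_space T a) (prob_algebra (path_space T (a + m)))"
proof (induction m)
  case (Suc m)
  then show ?case
    using measurable_bind_prob_space[OF Suc.IH measurable_step] by simp
qed simp

lemma traj_space:
  assumes "a + m \<le> N" "x \<in> space (path_space T a)"
  shows "prob_space (traj a m x)" "sets (traj a m x) = sets (path_space T (a + m))"
    "space (traj a m x) = space (path_space T (a + m))" "space (traj a m x) \<noteq> {}"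
proof -
  show *: "prob_space (traj a m x)" "sets (traj a m x) = sets (path_space T (a + m))"
    using measurable_space[OF measurable_traj assms(2)] assms(1) by (auto simp: space_prob_algebra)
  show "space (traj a m x) = space (path_space T (a + m))" by (rule sets_eq_imp_space_eq[OF *(2)])
  show "space (traj a m x) \<noteq> {}" by (rule prob_space.not_empty[OF *(1)])
qed

lemma measurable_on_traj:
  assumes "a + m \<le> N" "x \<in> space (path_space T a)" "f \<in> measurable (path_space T (a + m)) R"
  shows "f \<in> measurable (traj a m x) R"
  using assms(3) by (simp add: measurable_cong_sets[OF traj_space(2)[OF assms(1,2)] refl])

text \<open>The Chapman-Kolmogorov equation for path laws, from associativity of the bind.\<close>

lemma traj_add:
  assumes "a + m + n \<le> N" "x \<in> space (path_space T a)"
  shows "traj a (m + n) x = traj a m x \<bind> traj (a + m) n"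
  using assms
proof (induction n)
  case 0
  then show ?case using traj_space(2)[of a m x] by (simp add: bind_return'')
next
  case (Suc n)
  have "traj a (m + Suc n) x = (traj a m x \<bind> traj (a + m) n) \<bind> step (a + m + n)"
    using Suc by (simp add: add.assoc)
  also have "\<dots> = traj a m x \<bind> (\<lambda>y. traj (a + m) n y \<bind> step (a + m + n))"
  proof (rule bind_assoc)
    show "traj (a + m) n \<in> measurable (traj a m x) (subprob_algebra (path_space T (a + m + n)))"
      using Suc.prems by (intro measurable_on_traj measurable_prob_algebraD measurable_traj) auto
    show "step (a + m + n) \<in> measurable (path_space T (a + m + n)) (subprob_algebra (path_space T (Suc (a + m + n))))"
      using Suc.prems by (intro measurable_prob_algebraD measurable_step) auto
  qed
  finally show ?case by simp
qed

text \<open>A continuation \<open>w\<close> with its past exchanged for \<open>x\<close>. Different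
  pasts can thus be compared under a single law of \<open>w\<close>, without a joint law of two
  paths.\<close>

definition graft :: "nat \<Rightarrow> nat \<Rightarrow> (nat \<Rightarrow> 'a) \<Rightarrow> (nat \<Rightarrow> 'a) \<Rightarrow> nat \<Rightarrow> 'a" where
  "graft a b x w = (\<lambda>j\<in>{1..b}. if j \<le> a then x j else w j)"

lemma measurable_graft:
  assumes "a \<le> b" "x \<in> space (path_space T a)"
  shows "graft a b x \<in> measurable (path_space T b) (path_space T b)"
  unfolding path_space_def graft_def[abs_def]
proof (rule measurable_restrict)
  fix j assume j: "j \<in> {1..b}"
  show "(\<lambda>w. if j \<le> a then x j else w j) \<in> measurable (\<Pi>\<^sub>M i\<in>{1..b}. borel_sets_of (T i)) (borel_sets_of (T j))"
    using assms j by (cases "j \<le> a") (auto simp: space_path_space PiE_iff intro: measurable_component_singleton)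
qed

lemma graft_space:
  "a \<le> b \<Longrightarrow> x \<in> space (path_space T a) \<Longrightarrow> w \<in> space (path_space T b) \<Longrightarrow>
     graft a b x w \<in> space (path_space T b)"
  by (rule measurable_space[OF measurable_graft])

lemma graft_extend:
  assumes "a \<le> b"
  shows "graft a (Suc b) y ((graft a b x w)(Suc b := z)) = (graft a b y w)(Suc b := z)"
  using assms by (auto simp: graft_def fun_eq_iff)

text \<open>The induction step shared by the two grafting lemmas. As the law up to time
  \<open>a + m\<close> is invariant under \<open>g\<close>, the next state may be drawn from
  \<open>g w\<close> in place of \<open>w\<close>.\<close>

lemma distr_traj_step:
  assumes b: "a + m < N" and x: "x \<in> space (path_space T a)"
    and g: "g \<in> measurable (path_space T (a + m)) (path_space T (a + m))"
    and h: "h \<in> measurable (path_space T (Suc (a + m))) (path_space T (Suc (a + m)))"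
    and inv: "distr (traj a m x) (path_space T (a + m)) g = traj a m x"
  shows "distr (traj a (Suc m) x) (path_space T (Suc (a + m))) h
       = traj a m x \<bind> (\<lambda>w. distr (Q (a + m) (g w)) (path_space T (Suc (a + m))) (\<lambda>z. h ((g w)(Suc (a + m) := z))))"
proof -
  let ?b = "a + m" let ?S = "path_space T (Suc (a + m))"
  note tr = traj_space[of a m x]
  have st: "step ?b \<in> measurable (path_space T ?b) (subprob_algebra ?S)"
    using b by (intro measurable_prob_algebraD measurable_step)
  have dst: "(\<lambda>w. distr (step ?b w) ?S h) \<in> measurable (path_space T ?b) (subprob_algebra ?S)"
    by (rule measurable_compose[OF st measurable_distr[OF h]])
  have "distr (traj a (Suc m) x) ?S h = traj a m x \<bind> (\<lambda>w. distr (step ?b w) ?S h)"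
    unfolding traj.simps using b x st h tr
    by (intro distr_bind[where K = ?S] measurable_on_traj) auto
  also have "\<dots> = distr (traj a m x) (path_space T ?b) g \<bind> (\<lambda>w. distr (step ?b w) ?S h)"
    by (simp add: inv)
  also have "\<dots> = traj a m x \<bind> (\<lambda>w. distr (step ?b (g w)) ?S h)"
    using b x g dst tr by (intro bind_distr[where K = ?S] measurable_on_traj) auto
  also have "\<dots> = traj a m x \<bind> (\<lambda>w. distr (Q ?b (g w)) ?S (\<lambda>z. h ((g w)(Suc ?b := z))))"
  proof (rule bind_cong[OF refl])
    fix w assume "w \<in> space (traj a m x)"
    then have gw: "g w \<in> space (path_space T ?b)" using measurable_space[OF g] tr b x by simp
    show "distr (step ?b (g w)) ?S h = distr (Q ?b (g w)) ?S (\<lambda>z. h ((g w)(Suc ?b := z)))"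
      unfolding step_def by (simp add: distr_distr[OF h measurable_extend_Q[OF b gw]] comp_def)
  qed
  finally show ?thesis .
qed

lemma distr_traj_bind:
  assumes b: "a + m < N" and x: "x \<in> space (path_space T a)"
    and g: "g \<in> measurable (path_space T (a + m)) (path_space T (a + m))"
  shows "distr (traj a m x) (path_space T (a + m)) g \<bind> step (a + m)
       = traj a m x \<bind> (\<lambda>w. step (a + m) (g w))"
proof (rule bind_distr)
  show "g \<in> measurable (traj a m x) (path_space T (a + m))"
    using b x g by (intro measurable_on_traj) auto
  show "step (a + m) \<in> measurable (path_space T (a + m)) (subprob_algebra (path_space T (Suc (a + m))))"
    using b by (intro measurable_prob_algebraD measurable_step) auto
  show "space (traj a m x) \<noteq> {}" using traj_space(4)[of a m x] b x by simp
qed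

text \<open>\<open>step\<close> writes only the new coordinate, so a path started from
  \<open>x\<close> keeps \<open>x\<close> as its past.\<close>

lemma distr_traj_graft_self:
  assumes "a + m \<le> N" "x \<in> space (path_space T a)"
  shows "distr (traj a m x) (path_space T (a + m)) (graft a (a + m) x) = traj a m x"
  using assms
proof (induction m)
  case 0
  then have "graft a a x x = x" by (auto simp: graft_def space_path_space PiE_iff extensional_def fun_eq_iff)
  then show ?case
    using 0 distr_return[OF measurable_graft[of a a x] 0(2)] by simp
next
  case (Suc m)
  then have b: "a + m < N" and x: "x \<in> space (path_space T a)" by auto
  have IH: "distr (traj a m x) (path_space T (a + m)) (graft a (a + m) x) = traj a m x"
    using Suc b by simp
  have g: "graft a (a + m) x \<in> measurable (path_space T (a + m)) (path_space T (a + m))"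
    by (rule measurable_graft[OF _ x]) simp
  have h: "graft a (Suc (a + m)) x \<in> measurable (path_space T (Suc (a + m))) (path_space T (Suc (a + m)))"
    by (rule measurable_graft[OF _ x]) simp
  have "distr (traj a (Suc m) x) (path_space T (Suc (a + m))) (graft a (Suc (a + m)) x)
      = traj a m x \<bind> (\<lambda>w. step (a + m) (graft a (a + m) x w))"
    unfolding distr_traj_step[OF b x g h IH] step_def by (simp add: graft_extend)
  also have "\<dots> = traj a (Suc m) x"
    using distr_traj_bind[OF b x g] IH by simp
  finally show ?case by simp
qed

text \<open>The Markov property: later kernels see the past only through the state at time
  \<open>a\<close>, which \<open>x\<close> and \<open>y\<close> share, so both pasts have the same
  continuations in law.\<close>

lemma distr_traj_graft:
  assumes "a + m \<le> N" "1 \<le> a" "x \<in> space (path_space T a)" "y \<in> space (path_space T a)" "x a = y a"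
  shows "distr (traj a m x) (path_space T (a + m)) (graft a (a + m) y) = traj a m y"
  using assms
proof (induction m)
  case 0
  then have "graft a a y x = y" by (auto simp: graft_def space_path_space PiE_iff extensional_def fun_eq_iff)
  then show ?case
    using 0 distr_return[OF measurable_graft[of a a y] 0(3)] by simp
next
  case (Suc m)
  then have b: "a + m < N" and x: "x \<in> space (path_space T a)" and y: "y \<in> space (path_space T a)" by auto
  have IH: "distr (traj a m x) (path_space T (a + m)) (graft a (a + m) y) = traj a m y"
    using Suc b by simp
  have self: "distr (traj a m x) (path_space T (a + m)) (graft a (a + m) x) = traj a m x"
    using distr_traj_graft_self b x by simp
  \<comment> \<open>For \<open>m = 0\<close> the kernel reads the common state
    \<open>x a = y a\<close>; for larger \<open>m\<close> it reads \<open>w\<close> at a time that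
    grafting leaves alone.\<close>
  have "Q (a + m) (graft a (a + m) x w) = Q (a + m) (graft a (a + m) y w)" for w
    using Suc.prems by (auto simp: Q_def graft_def)
  note Q_eq = this
  have g: "graft a (a + m) z \<in> measurable (path_space T (a + m)) (path_space T (a + m))"
    if "z \<in> space (path_space T a)" for z
    by (rule measurable_graft[OF _ that]) simp
  have h: "graft a (Suc (a + m)) y \<in> measurable (path_space T (Suc (a + m))) (path_space T (Suc (a + m)))"
    by (rule measurable_graft[OF _ y]) simp
  have "distr (traj a (Suc m) x) (path_space T (Suc (a + m))) (graft a (Suc (a + m)) y)
      = traj a m x \<bind> (\<lambda>w. step (a + m) (graft a (a + m) y w))"
    unfolding distr_traj_step[OF b x g[OF x] h self] step_def by (simp add: graft_extend Q_eq)
  also have "\<dots> = traj a (Suc m) y"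
    using distr_traj_bind[OF b x g[OF y]] IH by simp
  finally show ?case by simp
qed

text \<open>The link to the mixing condition: \<open>dbar\<close> speaks of the state laws
  \<open>cond_law\<close>, the conditional means below are integrals against the path laws
  \<open>traj\<close>.\<close>

lemma traj_last:
  assumes "a + m \<le> N" "1 \<le> a" "x \<in> space (path_space T a)"
  shows "distr (traj a m x) (borel_sets_of (T (a + m))) (\<lambda>w. w (a + m)) = cond_law T K a m (x a)"
  using assms
proof (induction m)
  case 0
  then show ?case using distr_return[OF measurable_path_coord[of a a], of x] by simp
next
  case (Suc m)
  let ?b = "a + m" let ?B = "borel_sets_of (T (Suc ?b))"
  have b: "?b < N" and x: "x \<in> space (path_space T a)" using Suc by auto
  note tr = traj_space[of a m x]
  have st: "step ?b \<in> measurable (path_space T ?b) (subprob_algebra (path_space T (Suc ?b)))"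
    using b by (intro measurable_prob_algebraD measurable_step)
  have "distr (traj a (Suc m) x) ?B (\<lambda>w. w (Suc ?b)) = traj a m x \<bind> (\<lambda>w. distr (step ?b w) ?B (\<lambda>w. w (Suc ?b)))"
    unfolding traj.simps using b x st tr
    by (intro distr_bind[where K = "path_space T (Suc ?b)"] measurable_on_traj measurable_path_coord) auto
  also have "\<dots> = traj a m x \<bind> (\<lambda>w. K ?b (w ?b))"
  proof (rule bind_cong[OF refl])
    fix w assume "w \<in> space (traj a m x)"
    then have w: "w \<in> space (path_space T ?b)" using tr b x by simp
    have Qs: "sets (Q ?b w) = sets ?B"
      using measurable_space[OF measurable_Q[OF b] w] by (simp add: space_prob_algebra)
    have "distr (step ?b w) ?B (\<lambda>w. w (Suc ?b)) = distr (Q ?b w) ?B (\<lambda>z. z)"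
      unfolding step_def
      using distr_distr[OF measurable_path_coord[of "Suc ?b" "Suc ?b"] measurable_extend_Q[OF b w]]
      by (simp add: comp_def)
    also have "\<dots> = Q ?b w" using Qs by (intro distr_id2) simp
    finally show "distr (step ?b w) ?B (\<lambda>w. w (Suc ?b)) = K ?b (w ?b)"
      using \<open>1 \<le> a\<close> by (simp add: Q_def)
  qed
  also have "\<dots> = distr (traj a m x) (borel_sets_of (T ?b)) (\<lambda>w. w ?b) \<bind> K ?b"
  proof (rule bind_distr[symmetric])
    show "(\<lambda>w. w ?b) \<in> measurable (traj a m x) (borel_sets_of (T ?b))"
      using b x \<open>1 \<le> a\<close> by (intro measurable_on_traj measurable_path_coord) auto
    show "K ?b \<in> measurable (borel_sets_of (T ?b)) (subprob_algebra ?B)"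
      using b \<open>1 \<le> a\<close> by (intro measurable_prob_algebraD K) auto
    show "space (traj a m x) \<noteq> {}" using tr(4) b x by simp
  qed
  also have "distr (traj a m x) (borel_sets_of (T ?b)) (\<lambda>w. w ?b) = cond_law T K a m (x a)"
    by (rule Suc.IH) (use b x \<open>1 \<le> a\<close> in auto)
  finally show ?case by (simp del: traj.simps)
qed

end

section \<open>Conditional means of a Lipschitz functional\<close>

text \<open>Adding the bound \<open>B\<close> makes \<open>f\<close> nonnegative, so that the rule
  for nonnegative integrals applies. All measures involved have mass 1, so the shift adds exactly
  \<open>B\<close> to either side and cancels.\<close>

lemma integral_bind_prob_algebra:
  fixes f :: "'b \<Rightarrow> real"
  assumes M: "prob_space M" and Q: "Q \<in> measurable M (prob_algebra R)"
    and f: "f \<in> borel_measurable R" and bdd: "\<And>y. y \<in> space R \<Longrightarrow> \<bar>f y\<bar> \<le> B"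
  shows "(\<integral>y. f y \<partial>(M \<bind> Q)) = (\<integral>x. \<integral>y. f y \<partial>Q x \<partial>M)"
proof -
  interpret M: prob_space M by fact
  have Qs: "Q \<in> measurable M (subprob_algebra R)" by (rule measurable_prob_algebraD[OF Q])
  have MQ: "M \<bind> Q \<in> space (prob_algebra R)"
  proof -
    have "(\<lambda>_. M) \<in> measurable (count_space UNIV) (prob_algebra M)"
      by (simp add: space_prob_algebra M)
    from measurable_space[OF measurable_bind_prob_space[OF this Q]] show ?thesis by simp
  qed
  then interpret B: prob_space "M \<bind> Q" by (simp add: space_prob_algebra)
  have sB: "sets (M \<bind> Q) = sets R" using MQ by (simp add: space_prob_algebra)
  have Qx: "prob_space (Q x)" "sets (Q x) = sets R" "space (Q x) = space R" if "x \<in> space M" for x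
    using measurable_space[OF Q that] by (auto simp: space_prob_algebra dest: sets_eq_imp_space_eq)
  have shift: "ennreal (integral\<^sup>L D f + B) = (\<integral>\<^sup>+y. ennreal (f y + B) \<partial>D)"
    and bnd: "\<bar>integral\<^sup>L D f\<bar> \<le> B"
    if D: "prob_space D" "sets D = sets R" for D
  proof -
    interpret D: prob_space D by fact
    have sp: "space D = space R" by (rule sets_eq_imp_space_eq[OF D(2)])
    have fD: "f \<in> borel_measurable D" using f by (simp add: measurable_cong_sets[OF D(2) refl])
    have int: "integrable D f"
      by (rule D.integrable_const_bound[where B = B]) (auto intro!: AE_I2 bdd fD simp: sp)
    have "\<And>y. y \<in> space D \<Longrightarrow> 0 \<le> f y + B" using bdd by (force simp: sp abs_le_iff)
    then have "(\<integral>\<^sup>+y. ennreal (f y + B) \<partial>D) = ennreal (\<integral>y. f y + B \<partial>D)"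
      using int by (intro nn_integral_eq_integral) auto
    then show "ennreal (integral\<^sup>L D f + B) = (\<integral>\<^sup>+y. ennreal (f y + B) \<partial>D)"
      using int by (simp add: D.prob_space)
    have "\<bar>integral\<^sup>L D f\<bar> \<le> integral\<^sup>L D (\<lambda>y. \<bar>f y\<bar>)" by (rule integral_abs_bound)
    also have "\<dots> \<le> integral\<^sup>L D (\<lambda>y. B)"
      by (rule integral_mono) (use int bdd sp in auto)
    also have "\<dots> = B" by (simp add: D.prob_space)
    finally show "\<bar>integral\<^sup>L D f\<bar> \<le> B" .
  qed
  have Qf: "(\<lambda>x. integral\<^sup>L (Q x) f) \<in> borel_measurable M"
    by (rule measurable_compose[OF Qs integral_measurable_subprob_algebra[OF f]])
  have Qint: "integrable M (\<lambda>x. integral\<^sup>L (Q x) f)"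
    by (rule M.integrable_const_bound[where B = B]) (auto intro!: AE_I2 bnd Qx Qf)
  have nn: "0 \<le> integral\<^sup>L (Q x) f + B" if "x \<in> space M" for x
    using bnd[OF Qx(1,2)[OF that]] by linarith
  have "ennreal (integral\<^sup>L (M \<bind> Q) f + B) = (\<integral>\<^sup>+y. ennreal (f y + B) \<partial>(M \<bind> Q))"
    by (rule shift[OF B.prob_space_axioms sB])
  also have "\<dots> = (\<integral>\<^sup>+x. \<integral>\<^sup>+y. ennreal (f y + B) \<partial>Q x \<partial>M)"
    by (rule nn_integral_bind[OF _ Qs]) (use f in measurable)
  also have "\<dots> = (\<integral>\<^sup>+x. ennreal (integral\<^sup>L (Q x) f + B) \<partial>M)"
    by (rule nn_integral_cong) (simp add: shift Qx)
  also have "\<dots> = ennreal (\<integral>x. integral\<^sup>L (Q x) f + B \<partial>M)"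
    by (rule nn_integral_eq_integral) (use Qint nn in \<open>auto intro!: AE_I2\<close>)
  also have "\<dots> = ennreal ((\<integral>x. integral\<^sup>L (Q x) f \<partial>M) + B)"
    using Qint by (simp add: M.prob_space)
  finally show ?thesis
  proof (subst (asm) ennreal_inj)
    show "0 \<le> integral\<^sup>L (M \<bind> Q) f + B" using bnd[OF B.prob_space_axioms sB] by linarith
    have "0 \<le> (\<integral>x. integral\<^sup>L (Q x) f + B \<partial>M)"
      using nn by (intro integral_nonneg_AE AE_I2)
    then show "0 \<le> (\<integral>x. integral\<^sup>L (Q x) f \<partial>M) + B" using Qint by (simp add: M.prob_space)
  qed simp
qed

locale lipschitz_markov = markov_kernels +
  fixes f :: "(nat \<Rightarrow> 'a) \<Rightarrow> real" and c :: "nat \<Rightarrow> real"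
  assumes polish: "\<And>i. 1 \<le> i \<Longrightarrow> i \<le> N \<Longrightarrow> polish_topology (T i)"
    and f_meas: "f \<in> borel_measurable (path_space T N)"
    and c_nonneg: "\<And>i. 1 \<le> i \<Longrightarrow> i \<le> N \<Longrightarrow> 0 \<le> c i"
    and f_lipschitz: "\<And>x y. x \<in> space (path_space T N) \<Longrightarrow> y \<in> space (path_space T N) \<Longrightarrow>
           f x - f y \<le> (\<Sum>i\<in>{1..N}. c i * of_bool (x i \<noteq> y i))"
begin

lemma f_bounded: "\<exists>B. \<forall>x\<in>space (path_space T N). \<bar>f x\<bar> \<le> B"
proof (cases "space (path_space T N) = {}")
  case False
  then obtain x0 where x0: "x0 \<in> space (path_space T N)" by blast
  have le: "(\<Sum>i\<in>{1..N}. c i * of_bool (x i \<noteq> y i)) \<le> (\<Sum>i\<in>{1..N}. c i)" for x y :: "nat \<Rightarrow> 'a"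
    using c_nonneg by (intro sum_mono) auto
  have "\<bar>f x\<bar> \<le> \<bar>f x0\<bar> + (\<Sum>i\<in>{1..N}. c i)" if "x \<in> space (path_space T N)" for x
    using f_lipschitz[OF that x0] f_lipschitz[OF x0 that] le[of x x0] le[of x0 x] by linarith
  then show ?thesis by blast
qed auto

text \<open>The Doob martingale of \<open>f\<close>: the conditional mean given the path up to time
  \<open>a\<close>. Built from the kernels, it is defined for every \<open>x\<close> rather than up
  to null sets, so its oscillation can be bounded pointwise.\<close>

definition F :: "nat \<Rightarrow> (nat \<Rightarrow> 'a) \<Rightarrow> real" where
  "F a x = (\<integral>w. f w \<partial>traj a (N - a) x)"

lemma measurable_F: "a \<le> N \<Longrightarrow> F a \<in> borel_measurable (path_space T a)"
  unfolding F_def[abs_def]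
  by (rule measurable_compose[OF measurable_prob_algebraD[OF measurable_traj]
        integral_measurable_subprob_algebra]) (use f_meas in auto)

lemma F_last: "x \<in> space (path_space T N) \<Longrightarrow> F N x = f x"
  unfolding F_def by (simp add: integral_return f_meas)

text \<open>The martingale property, from \<open>traj_add\<close>.\<close>

lemma F_tower:
  assumes "a + m \<le> N" "x \<in> space (path_space T a)"
  shows "F a x = (\<integral>w. F (a + m) w \<partial>traj a m x)"
proof -
  obtain B where B: "\<And>x. x \<in> space (path_space T N) \<Longrightarrow> \<bar>f x\<bar> \<le> B" using f_bounded by blast
  have "N - a = m + (N - (a + m))" using assms by simp
  then have "F a x = (\<integral>w. f w \<partial>(traj a m x \<bind> traj (a + m) (N - (a + m))))"
    using traj_add[of a m "N - (a + m)" x] assms by (simp add: F_def)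
  also have "\<dots> = (\<integral>w. F (a + m) w \<partial>traj a m x)"
    unfolding F_def
  proof (rule integral_bind_prob_algebra[OF traj_space(1)[OF assms] _ f_meas B])
    show "traj (a + m) (N - (a + m)) \<in> measurable (traj a m x) (prob_algebra (path_space T N))"
      using measurable_traj[of "a + m" "N - (a + m)"] assms by (intro measurable_on_traj) auto
  qed
  finally show ?thesis .
qed

lemma F_bounded: "\<exists>B. \<forall>a\<le>N. \<forall>x\<in>space (path_space T a). \<bar>F a x\<bar> \<le> B"
proof -
  obtain B where B: "\<And>x. x \<in> space (path_space T N) \<Longrightarrow> \<bar>f x\<bar> \<le> B" using f_bounded by blast
  have "\<bar>F a x\<bar> \<le> B" if "a \<le> N" "x \<in> space (path_space T a)" for a x
  proof -
    have aN: "a + (N - a) \<le> N" using that by simp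
    interpret prob_space "traj a (N - a) x" by (rule traj_space(1)[OF aN that(2)])
    have sp: "space (traj a (N - a) x) = space (path_space T N)"
      using traj_space(3)[OF aN that(2)] that by simp
    have fm: "f \<in> borel_measurable (traj a (N - a) x)"
      using measurable_on_traj[OF aN that(2)] f_meas that by simp
    have int: "integrable (traj a (N - a) x) f"
      by (rule integrable_const_bound[where B = B]) (auto intro!: AE_I2 B fm simp: sp)
    have "\<bar>F a x\<bar> \<le> (\<integral>w. \<bar>f w\<bar> \<partial>traj a (N - a) x)" unfolding F_def by (rule integral_abs_bound)
    also have "\<dots> \<le> (\<integral>w. B \<partial>traj a (N - a) x)"
      by (rule integral_mono) (use int B sp in auto)
    finally show ?thesis by (simp add: prob_space)
  qed
  then show ?thesis by blast
qed

lemma measurable_F_graft: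
  assumes "a + m \<le> N" "x \<in> space (path_space T a)" "y \<in> space (path_space T a)"
  shows "(\<lambda>w. F (a + m) (graft a (a + m) y w)) \<in> borel_measurable (traj a m x)"
  by (rule measurable_on_traj[OF assms(1,2) measurable_compose[OF measurable_graft measurable_F]])
    (use assms in auto)

lemma integrable_F_graft:
  assumes "a + m \<le> N" "x \<in> space (path_space T a)" "y \<in> space (path_space T a)"
  shows "integrable (traj a m x) (\<lambda>w. F (a + m) (graft a (a + m) y w))"
proof -
  obtain B where B: "\<forall>a\<le>N. \<forall>x\<in>space (path_space T a). \<bar>F a x\<bar> \<le> B" using F_bounded by blast
  interpret prob_space "traj a m x" by (rule traj_space(1)[OF assms(1,2)])
  show ?thesis
    by (rule integrable_const_bound[where B = B])
      (use B assms graft_space[of a "a + m" y] traj_space(3)[OF assms(1,2)] measurable_F_graft[OF assms]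
        in \<open>auto intro!: AE_I2\<close>)
qed

lemma F_graft_self:
  assumes "a + m \<le> N" "x \<in> space (path_space T a)"
  shows "F a x = (\<integral>w. F (a + m) (graft a (a + m) x w) \<partial>traj a m x)"
proof -
  have g: "graft a (a + m) x \<in> measurable (traj a m x) (path_space T (a + m))"
    using assms by (intro measurable_on_traj measurable_graft) auto
  show ?thesis
    unfolding F_tower[OF assms]
    by (subst distr_traj_graft_self[OF assms, symmetric])
      (rule integral_distr[OF g measurable_F[OF assms(1)]])
qed

text \<open>When the current states agree, the Markov property lets the mean given \<open>y\<close>
  be computed with the continuations of \<open>x\<close>, so that comparing it with
  \<open>F a x\<close> needs no change of measure.\<close>

lemma F_graft:
  assumes "a + m \<le> N" "1 \<le> a" "x \<in> space (path_space T a)" "y \<in> space (path_space T a)" "x a = y a"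
  shows "F a y = (\<integral>w. F (a + m) (graft a (a + m) y w) \<partial>traj a m x)"
proof -
  have g: "graft a (a + m) y \<in> measurable (traj a m x) (path_space T (a + m))"
    using assms by (intro measurable_on_traj measurable_graft) auto
  show ?thesis
    unfolding F_tower[OF assms(1,4)]
    by (subst distr_traj_graft[OF assms, symmetric])
      (rule integral_distr[OF g measurable_F[OF assms(1)]])
qed

text \<open>The term with \<open>B\<close> is the influence of the current state \<open>x a\<close> through the future of the chain.\<close>

definition lip :: "nat \<Rightarrow> real \<Rightarrow> bool" where
  "lip a B \<longleftrightarrow> (\<forall>x\<in>space (path_space T a). \<forall>y\<in>space (path_space T a).
     F a x - F a y \<le> (\<Sum>j\<in>{1..a}. c j * of_bool (x j \<noteq> y j)) + B * of_bool (x a \<noteq> y a))"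

lemma lip_last: "lip N 0"
  using f_lipschitz by (simp add: lip_def F_last)

text \<open>On a common past the terms up to time \<open>a\<close> vanish, and every later state may
  change at its full weight. The term with \<open>B\<close> stays separate because it depends on the
  last state only, which is what mixing controls.\<close>

lemma lip_graft_same:
  assumes "a + m \<le> N" "1 \<le> m" "lip (a + m) B" "0 \<le> B"
    and "x \<in> space (path_space T a)" "w \<in> space (path_space T (a + m))" "w' \<in> space (path_space T (a + m))"
  shows "F (a + m) (graft a (a + m) x w) - F (a + m) (graft a (a + m) x w')
     \<le> (\<Sum>j\<in>{a<..a + m}. c j) + B * of_bool (w (a + m) \<noteq> w' (a + m))"
proof -
  let ?b = "a + m" let ?g = "graft a ?b x"
  have "F ?b (?g w) - F ?b (?g w')
     \<le> (\<Sum>j\<in>{1..?b}. c j * of_bool (?g w j \<noteq> ?g w' j)) + B * of_bool (?g w ?b \<noteq> ?g w' ?b)"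
    using assms(3) graft_space[of a ?b x] assms(5-7) by (simp add: lip_def)
  also have "(\<Sum>j\<in>{1..?b}. c j * of_bool (?g w j \<noteq> ?g w' j))
      = (\<Sum>j\<in>{a<..?b}. c j * of_bool (?g w j \<noteq> ?g w' j))"
    by (rule sum.mono_neutral_right) (auto simp: graft_def)
  also have "\<dots> \<le> (\<Sum>j\<in>{a<..?b}. c j)"
    using assms(1) by (intro sum_mono) (auto simp: c_nonneg)
  also have "B * of_bool (?g w ?b \<noteq> ?g w' ?b) = B * of_bool (w ?b \<noteq> w' ?b)"
    using assms(2) by (simp add: graft_def)
  finally show ?thesis by simp
qed

text \<open>The continuation is shared, and by \<open>1 \<le> m\<close> it contains time
  \<open>a + m\<close>; hence the term with \<open>B\<close> vanishes and only the pasts are paid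
  for.\<close>

lemma lip_graft_prefix:
  assumes "a + m \<le> N" "1 \<le> m" "lip (a + m) B"
    and "x \<in> space (path_space T a)" "y \<in> space (path_space T a)" "w \<in> space (path_space T (a + m))"
  shows "F (a + m) (graft a (a + m) x w) - F (a + m) (graft a (a + m) y w)
     \<le> (\<Sum>j\<in>{1..a}. c j * of_bool (x j \<noteq> y j))"
proof -
  let ?b = "a + m"
  let ?gx = "graft a ?b x w" and ?gy = "graft a ?b y w"
  have "F ?b ?gx - F ?b ?gy
     \<le> (\<Sum>j\<in>{1..?b}. c j * of_bool (?gx j \<noteq> ?gy j)) + B * of_bool (?gx ?b \<noteq> ?gy ?b)"
    using assms(3) graft_space[of a ?b] assms(4-6) by (simp add: lip_def)
  also have "(\<Sum>j\<in>{1..?b}. c j * of_bool (?gx j \<noteq> ?gy j)) = (\<Sum>j\<in>{1..a}. c j * of_bool (?gx j \<noteq> ?gy j))"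
    by (rule sum.mono_neutral_right) (auto simp: graft_def)
  also have "\<dots> = (\<Sum>j\<in>{1..a}. c j * of_bool (x j \<noteq> y j))"
    by (rule sum.cong) (auto simp: graft_def)
  also have "B * of_bool (?gx ?b \<noteq> ?gy ?b) = 0" using assms(2) by (simp add: graft_def)
  finally show ?thesis by simp
qed

text \<open>One backward step of the recursion for the influence of a block's last state. First the
  past is exchanged under the law started from \<open>x\<close>. Then, only if the current states
  differ, the law itself is exchanged by \<open>integral_le_of_marginal_tv\<close>.\<close>

lemma lip_step:
  assumes "1 \<le> a" and m: "a + m \<le> N" "1 \<le> m" and lip: "lip (a + m) B" and nonneg: "0 \<le> B" "0 \<le> \<epsilon>"
    and tv: "\<And>u v D. u \<in> topspace (T a) \<Longrightarrow> v \<in> topspace (T a) \<Longrightarrow>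
           D \<in> sets (borel_sets_of (T (a + m))) \<Longrightarrow>
           measure (cond_law T K a m u) D \<le> measure (cond_law T K a m v) D + \<epsilon>"
  shows "lip a ((\<Sum>j\<in>{a<..a + m}. c j) + \<epsilon> * B)"
  unfolding lip_def
proof (intro ballI)
  fix x y assume x: "x \<in> space (path_space T a)" and y: "y \<in> space (path_space T a)"
  let ?b = "a + m" let ?S = "\<Sum>j\<in>{1..a}. c j * of_bool (x j \<noteq> y j)"
  let ?G = "\<lambda>w. F ?b (graft a ?b y w)"
  interpret X: prob_space "traj a m x" by (rule traj_space(1)[OF m(1) x])
  have spx: "space (traj a m x) = space (path_space T ?b)" by (rule traj_space(3)[OF m(1) x])
  have spy: "space (traj a m y) = space (path_space T ?b)" by (rule traj_space(3)[OF m(1) y])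
  have "F a x = (\<integral>w. F ?b (graft a ?b x w) \<partial>traj a m x)" by (rule F_graft_self[OF m(1) x])
  also have "\<dots> \<le> (\<integral>w. ?S + ?G w \<partial>traj a m x)"
  proof (rule integral_mono)
    fix w assume "w \<in> space (traj a m x)"
    then show "F ?b (graft a ?b x w) \<le> ?S + ?G w"
      using lip_graft_prefix[OF m lip x y, of w] by (simp add: spx)
  qed (use integrable_F_graft[OF m(1) x] x y in auto)
  also have "\<dots> = ?S + (\<integral>w. ?G w \<partial>traj a m x)"
    using integrable_F_graft[OF m(1) x y] by (simp add: X.prob_space)
  finally have 1: "F a x \<le> ?S + (\<integral>w. ?G w \<partial>traj a m x)" .
  show "F a x - F a y \<le> ?S + ((\<Sum>j\<in>{a<..a + m}. c j) + \<epsilon> * B) * of_bool (x a \<noteq> y a)"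
  proof (cases "x a = y a")
    case True
    then show ?thesis using 1 F_graft[OF m(1) \<open>1 \<le> a\<close> x y True] by simp
  next
    case False
    have last: "measure (traj a m z) {w \<in> space (traj a m z). w ?b \<in> D} = measure (cond_law T K a m (z a)) D"
      if z: "z \<in> space (path_space T a)" and D: "D \<in> sets (borel_sets_of (T ?b))" for z D
    proof -
      have "(\<lambda>w. w ?b) \<in> measurable (traj a m z) (borel_sets_of (T ?b))"
        using \<open>1 \<le> a\<close> by (intro measurable_on_traj[OF m(1) z] measurable_path_coord) auto
      from measure_distr[OF this D] show ?thesis
        unfolding traj_last[OF m(1) \<open>1 \<le> a\<close> z] by (simp add: vimage_def Int_def conj_commute)
    qed
    have "(\<integral>w. ?G w \<partial>traj a m x) \<le> (\<integral>w. ?G w \<partial>traj a m y) + (\<Sum>j\<in>{a<..?b}. c j) + \<epsilon> * B"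
    proof (rule integral_le_of_marginal_tv[where T = T and I = "{1..?b}" and b = ?b])
      show "sets (traj a m x) = sets (\<Pi>\<^sub>M i\<in>{1..?b}. borel_sets_of (T i))"
        "sets (traj a m y) = sets (\<Pi>\<^sub>M i\<in>{1..?b}. borel_sets_of (T i))"
        using traj_space(2)[OF m(1)] x y by (simp_all add: path_space_def)
      show "prob_space (traj a m x)" "prob_space (traj a m y)"
        using traj_space(1)[OF m(1)] x y by auto
      show "?G \<in> borel_measurable (\<Pi>\<^sub>M i\<in>{1..?b}. borel_sets_of (T i))"
        using measurable_compose[OF measurable_graft[of a ?b y] measurable_F[OF m(1)]] y
        by (simp add: path_space_def)
      show "measure (traj a m x) {w \<in> space (traj a m x). w ?b \<in> D}
          \<le> measure (traj a m y) {w \<in> space (traj a m y). w ?b \<in> D} + \<epsilon>"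
        if "D \<in> sets (borel_sets_of (T ?b))" for D
        unfolding last[OF x that] last[OF y that]
        by (rule tv) (use x y \<open>1 \<le> a\<close> that in \<open>auto simp: space_path_space PiE_iff\<close>)
      show "?G w - ?G w' \<le> (\<Sum>j\<in>{a<..?b}. c j) + B * of_bool (w ?b \<noteq> w' ?b)"
        if "w \<in> space (traj a m x)" "w' \<in> space (traj a m x)" for w w'
        using lip_graft_same[OF m lip nonneg(1) y] that by (simp add: spx)
      show "0 \<le> (\<Sum>j\<in>{a<..?b}. c j)" using m by (intro sum_nonneg c_nonneg) auto
    qed (use polish m nonneg \<open>1 \<le> a\<close> in auto)
    then show ?thesis using 1 False F_graft_self[OF m(1) y] by simp
  qed
qed

text \<open>Hoeffding's lemma for the increment over one block: given \<open>x\<close>, the variable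
  \<open>F (a + m)\<close> has mean \<open>F a x\<close> and almost surely lies in an interval of
  length \<open>(\<Sum>j\<in>{a<..a + m}. c j) + B\<close>.\<close>

lemma mgf_step:
  assumes m: "a + m \<le> N" and lip: "lip (a + m) B" and B: "0 \<le> B"
    and x: "x \<in> space (path_space T a)" and l: "0 < l"
  shows "(\<integral>\<^sup>+w. ennreal (exp (l * F (a + m) w)) \<partial>traj a m x)
     \<le> ennreal (exp (l * F a x + l\<^sup>2 * ((\<Sum>j\<in>{a<..a + m}. c j) + B)\<^sup>2 / 8))"
proof (cases "m = 0")
  \<comment> \<open>An empty block, as occurs once the block boundaries have reached
    \<open>N\<close>: \<open>lip_graft_same\<close> does not apply, but the law is a point mass at
    \<open>x\<close>.\<close>
  case True
  then show ?thesis
    using x nn_integral_return[OF x, of "\<lambda>w. ennreal (exp (l * F a w))"] measurable_F[of a] m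
    by (auto intro!: ennreal_leI)
next
  case False
  let ?b = "a + m" let ?R = "(\<Sum>j\<in>{a<..a + m}. c j) + B"
  \<comment> \<open>The path extends \<open>x\<close> only almost surely; grafting makes the range
    bound hold at every \<open>w\<close> without altering the law.\<close>
  let ?G = "\<lambda>w. F ?b (graft a ?b x w)"
  interpret prob_space "traj a m x" by (rule traj_space(1)[OF m x])
  have sp: "space (traj a m x) = space (path_space T ?b)" by (rule traj_space(3)[OF m x])
  define lo where "lo = (INF w\<in>space (traj a m x). ?G w)"
  obtain Bf where Bf: "\<forall>a\<le>N. \<forall>x\<in>space (path_space T a). \<bar>F a x\<bar> \<le> Bf" using F_bounded by blast
  have osc: "?G w - ?G w' \<le> ?R" if "w \<in> space (traj a m x)" "w' \<in> space (traj a m x)" for w w'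
  proof -
    have "?G w - ?G w' \<le> (\<Sum>j\<in>{a<..?b}. c j) + B * of_bool (w ?b \<noteq> w' ?b)"
      using lip_graft_same[OF m _ lip B x, of w w'] that False by (simp add: sp)
    also have "\<dots> \<le> ?R" using B by simp
    finally show ?thesis .
  qed
  have lo_le: "lo \<le> ?G w" if w: "w \<in> space (traj a m x)" for w
    unfolding lo_def
  proof (rule cINF_lower[OF _ w], rule bdd_belowI2)
    fix w' assume "w' \<in> space (traj a m x)"
    then show "- Bf \<le> ?G w'" using Bf m graft_space[of a ?b x w'] x sp by (force simp: abs_le_iff)
  qed
  have le_lo: "?G w \<le> lo + ?R" if w: "w \<in> space (traj a m x)" for w
  proof -
    have "?G w - ?R \<le> lo"
      unfolding lo_def by (rule cINF_greatest) (use not_empty osc[OF w] in \<open>auto simp: algebra_simps\<close>)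
    then show ?thesis by simp
  qed
  interpret interval_bounded_random_variable "traj a m x" ?G lo "lo + ?R"
    by unfold_locales (use measurable_F_graft[OF m x x] lo_le le_lo in \<open>auto intro!: AE_I2\<close>)
  have g: "graft a ?b x \<in> measurable (traj a m x) (path_space T ?b)"
    using m x by (intro measurable_on_traj measurable_graft) auto
  have "(\<integral>\<^sup>+w. ennreal (exp (l * F ?b w)) \<partial>traj a m x) = (\<integral>\<^sup>+w. ennreal (exp (l * ?G w)) \<partial>traj a m x)"
    by (subst distr_traj_graft_self[OF m x, symmetric], rule nn_integral_distr[OF g])
      (use measurable_F[OF m] in measurable)
  also have "\<dots> = (\<integral>\<^sup>+w. ennreal (exp (l * F a x)) * ennreal (exp (l * (?G w - F a x))) \<partial>traj a m x)"
    by (rule nn_integral_cong) (simp flip: ennreal_mult exp_add add: algebra_simps)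
  also have "\<dots> = ennreal (exp (l * F a x)) * (\<integral>\<^sup>+w. ennreal (exp (l * (?G w - F a x))) \<partial>traj a m x)"
    by (rule nn_integral_cmult) (use measurable_F_graft[OF m x x] in measurable)
  also have "(\<integral>\<^sup>+w. ennreal (exp (l * (?G w - F a x))) \<partial>traj a m x) \<le> ennreal (exp (l\<^sup>2 * ?R\<^sup>2 / 8))"
    using Hoeffdings_lemma_nn_integral[OF l] by (simp add: F_graft_self[OF m x])
  also have "ennreal (exp (l * F a x)) * \<dots> = ennreal (exp (l * F a x + l\<^sup>2 * ?R\<^sup>2 / 8))"
    by (simp flip: ennreal_mult exp_add)
  finally show ?thesis by (simp add: mult_left_mono)
qed

end

section \<open>Masses of boxes, and the mixing coefficient as a bound on state laws\<close>

context markov_kernels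
begin

lemma undefined_path_space [simp]: "(\<lambda>_. undefined) \<in> space (path_space T 0)"
  by (simp add: space_path_space)

text \<open>Boxes determine a finite measure on path space, and this product is the integrand that
  the Markov condition yields for the sampled chain.\<close>

lemma emeasure_step_PiE:
  assumes i: "i < N" and x: "x \<in> space (path_space T i)"
    and A: "\<And>j. j \<in> {1..Suc i} \<Longrightarrow> A j \<in> sets (borel_sets_of (T j))"
  shows "emeasure (step i x) (\<Pi>\<^sub>E j\<in>{1..Suc i}. A j)
       = indicator (\<Pi>\<^sub>E j\<in>{1..i}. A j) x * emeasure (Q i x) (A (Suc i))"
proof -
  have PA: "(\<Pi>\<^sub>E j\<in>{1..Suc i}. A j) \<in> sets (path_space T (Suc i))"
    unfolding path_space_def by (rule sets_PiM_I_finite) (use A in auto)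
  have sp: "space (Q i x) = space (borel_sets_of (T (Suc i)))"
    using measurable_space[OF measurable_Q[OF i] x] by (auto simp: space_prob_algebra dest: sets_eq_imp_space_eq)
  have "(\<lambda>z. x(Suc i := z)) -` (\<Pi>\<^sub>E j\<in>{1..Suc i}. A j) \<inter> space (Q i x)
      = (if x \<in> (\<Pi>\<^sub>E j\<in>{1..i}. A j) then A (Suc i) else {})"
  proof (rule set_eqI)
    fix z
    have "x(Suc i := z) \<in> (\<Pi>\<^sub>E j\<in>{1..Suc i}. A j) \<longleftrightarrow> z \<in> A (Suc i) \<and> x \<in> (\<Pi>\<^sub>E j\<in>{1..i}. A j)"
    proof -
      have "x \<in> extensional {1..i}" using x by (simp add: space_path_space PiE_iff)
      then have "x(Suc i := z) \<in> extensional {1..Suc i}" by (auto simp: extensional_def)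
      then show ?thesis
        using \<open>x \<in> extensional {1..i}\<close> by (auto simp: PiE_iff atLeastAtMostSuc_conv)
    qed
    then show "z \<in> (\<lambda>z. x(Suc i := z)) -` (\<Pi>\<^sub>E j\<in>{1..Suc i}. A j) \<inter> space (Q i x)
        \<longleftrightarrow> z \<in> (if x \<in> (\<Pi>\<^sub>E j\<in>{1..i}. A j) then A (Suc i) else {})"
      using sets.sets_into_space[OF A[of "Suc i"]] by (auto simp: sp)
  qed
  then show ?thesis
    unfolding step_def emeasure_distr[OF measurable_extend_Q[OF i x] PA]
    by (simp only: indicator_def) simp
qed

lemma measurable_cond_law:
  "1 \<le> i \<Longrightarrow> i + t \<le> N \<Longrightarrow>
     cond_law T K i t \<in> measurable (borel_sets_of (T i)) (prob_algebra (borel_sets_of (T (i + t))))"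
proof (induction t)
  case 0
  have "cond_law T K i 0 = return (borel_sets_of (T i))" by (simp add: fun_eq_iff)
  then show ?case by simp
next
  case (Suc t)
  have "(\<lambda>x. cond_law T K i t x \<bind> K (i + t)) \<in> measurable (borel_sets_of (T i)) (prob_algebra (borel_sets_of (T (Suc (i + t)))))"
    using Suc by (intro measurable_bind_prob_space[OF Suc.IH K]) auto
  moreover have "cond_law T K i (Suc t) = (\<lambda>x. cond_law T K i t x \<bind> K (i + t))" by (simp add: fun_eq_iff)
  ultimately show ?case by simp
qed

text \<open>The form in which \<open>dbar\<close> enters \<open>lip_step\<close>. A supremum of
  reals dominates its members only if the family is bounded; both suprema are over families bounded
  by 1.\<close>

lemma measure_cond_law_le_dbar:
  assumes i: "1 \<le> i" "i + t \<le> N" and u: "u \<in> topspace (T i)" and v: "v \<in> topspace (T i)"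
    and D: "D \<in> sets (borel_sets_of (T (i + t)))"
  shows "measure (cond_law T K i t u) D \<le> measure (cond_law T K i t v) D + dbar N T K t"
proof -
  have law: "prob_space (cond_law T K i t x)" "sets (cond_law T K i t x) = sets (borel_sets_of (T (i + t)))"
    if "x \<in> topspace (T i)" for x
    using measurable_space[OF measurable_cond_law[OF i], of x] that by (auto simp: space_prob_algebra)
  have diff_le: "\<bar>measure (cond_law T K i t x) A - measure (cond_law T K i t y) A\<bar> \<le> 1"
    if "x \<in> topspace (T i)" "y \<in> topspace (T i)" for x y A
  proof -
    interpret x: prob_space "cond_law T K i t x" by (rule law(1)[OF that(1)])
    interpret y: prob_space "cond_law T K i t y" by (rule law(1)[OF that(2)])
    show ?thesis
      using x.prob_le_1[of A] y.prob_le_1[of A] measure_nonneg[of "cond_law T K i t x" A]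
        measure_nonneg[of "cond_law T K i t y" A] by linarith
  qed
  have tv_le: "tv_dist (cond_law T K i t x) (cond_law T K i t y) \<le> 1"
    if "x \<in> topspace (T i)" "y \<in> topspace (T i)" for x y
    unfolding tv_dist_def by (rule cSUP_least) (use diff_le[OF that] sets.empty_sets in blast)+
  have "measure (cond_law T K i t u) D - measure (cond_law T K i t v) D
      \<le> \<bar>measure (cond_law T K i t u) D - measure (cond_law T K i t v) D\<bar>" by simp
  also have "\<dots> \<le> tv_dist (cond_law T K i t u) (cond_law T K i t v)"
    unfolding tv_dist_def
    by (rule cSUP_upper, use D law(2)[OF u] in simp, rule bdd_aboveI2[of _ _ 1]) (rule diff_le[OF u v])
  also have "\<dots> \<le> (SUP (x, y)\<in>topspace (T i) \<times> topspace (T i).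
                        tv_dist (cond_law T K i t x) (cond_law T K i t y))"
  proof -
    have "bdd_above ((\<lambda>(x, y). tv_dist (cond_law T K i t x) (cond_law T K i t y)) ` (topspace (T i) \<times> topspace (T i)))"
      by (rule bdd_aboveI2[of _ _ 1]) (auto intro: tv_le)
    from cSUP_upper[OF _ this, of "(u, v)"] u v show ?thesis by simp
  qed
  also have "\<dots> \<le> dbar N T K t"
    unfolding dbar_def using i by (auto intro!: Max_ge)
  finally show ?thesis by simp
qed

end

section \<open>The law of a Markov chain\<close>

text \<open>The almost sure identity of the Markov condition is integrated over an event of the
  past, which removes conditional expectations from all that follows.\<close>

lemma markov_chain_step_emeasure:
  assumes chain: "markov_chain P N T K X" and i: "1 \<le> i" "i < N"
    and B: "B \<in> sets (path_space T i)" and A: "A \<in> sets (borel_sets_of (T (Suc i)))"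
  shows "emeasure P {\<omega> \<in> space P. sample_path X i \<omega> \<in> B \<and> X (Suc i) \<omega> \<in> A}
       = (\<integral>\<^sup>+\<omega>. indicator B (sample_path X i \<omega>) * emeasure (K i (X i \<omega>)) A \<partial>P)"
proof -
  interpret P: prob_space P using chain by (simp add: markov_chain_def)
  have Xm: "X j \<in> measurable P (borel_sets_of (T j))" if "1 \<le> j" "j \<le> N" for j
    using chain that by (auto simp: markov_chain_def)
  have Km: "K i \<in> measurable (borel_sets_of (T i)) (prob_algebra (borel_sets_of (T (Suc i))))"
    using chain i by (auto simp: markov_chain_def)
  have Sm: "sample_path X i \<in> measurable P (path_space T i)"
    unfolding sample_path_def[abs_def] path_space_def by (rule measurable_restrict) (use i Xm in auto)
  let ?F = "vimage_algebra (space P) (sample_path X i) (path_space T i)"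
  have sub: "subalgebra P ?F"
    using sets_image_in_sets[OF refl Sm] by (simp add: subalgebra_def)
  interpret finite_measure_subalgebra P ?F by unfold_locales (rule sub)
  let ?E = "sample_path X i -` B \<inter> space P"
  let ?h = "\<lambda>\<omega>. indicator A (X (Suc i) \<omega>) :: real"
  let ?k = "\<lambda>\<omega>. measure (K i (X i \<omega>)) A"
  have E: "?E \<in> sets ?F" by (rule in_vimage_algebra[OF B])
  have EP: "?E \<in> sets P" by (rule measurable_sets[OF Sm B])
  have hm: "?h \<in> borel_measurable P"
    using Xm[of "Suc i"] i A by (intro measurable_compose[OF Xm borel_measurable_indicator]) auto
  have hint: "integrable P ?h"
    by (rule P.integrable_const_bound[OF _ hm, of 1]) (auto intro!: AE_I2 simp: indicator_def)
  have km: "?k \<in> borel_measurable P"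
    by (rule measurable_compose[OF Xm measurable_compose[OF Km measurable_measure_prob_algebra[OF A]]]) (use i in auto)
  have Kp: "prob_space (K i (X i \<omega>))" if "\<omega> \<in> space P" for \<omega>
    using measurable_space[OF Km measurable_space[OF Xm that]] i by (auto simp: space_prob_algebra)
  have ae: "AE \<omega> in P. real_cond_exp P ?F ?h \<omega> = ?k \<omega>"
    using chain i A by (auto simp: markov_chain_def)
  have kint: "integrable P (\<lambda>\<omega>. indicator ?E \<omega> * ?k \<omega>)"
  proof (rule P.integrable_const_bound[where B = 1])
    show "AE \<omega> in P. norm (indicator ?E \<omega> * ?k \<omega>) \<le> 1"
      by (rule AE_I2) (auto simp: indicator_def intro: prob_space.prob_le_1 Kp)
  qed (use EP km in measurable)
  have "{\<omega> \<in> space P. sample_path X i \<omega> \<in> B \<and> X (Suc i) \<omega> \<in> A} = ?E \<inter> (X (Suc i) -` A \<inter> space P)"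
    by auto
  then have "measure P {\<omega> \<in> space P. sample_path X i \<omega> \<in> B \<and> X (Suc i) \<omega> \<in> A}
      = (\<integral>\<omega>. indicator (?E \<inter> (X (Suc i) -` A \<inter> space P)) \<omega> \<partial>P)"
    by (simp add: Int_assoc)
  also have "\<dots> = (\<integral>\<omega>\<in>?E. ?h \<omega> \<partial>P)"
    unfolding set_lebesgue_integral_def by (rule Bochner_Integration.integral_cong) (auto simp: indicator_def)
  also have "\<dots> = (\<integral>\<omega>\<in>?E. real_cond_exp P ?F ?h \<omega> \<partial>P)" by (rule real_cond_exp_intA[OF hint E])
  also have "\<dots> = (\<integral>\<omega>. indicator ?E \<omega> * ?k \<omega> \<partial>P)"
    unfolding set_lebesgue_integral_def
    by (rule integral_cong_AE) (use ae EP km in \<open>auto intro: borel_measurable_cond_exp2\<close>)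
  finally have "emeasure P {\<omega> \<in> space P. sample_path X i \<omega> \<in> B \<and> X (Suc i) \<omega> \<in> A}
      = ennreal (\<integral>\<omega>. indicator ?E \<omega> * ?k \<omega> \<partial>P)"
    by (simp add: P.emeasure_eq_measure)
  also have "\<dots> = (\<integral>\<^sup>+\<omega>. ennreal (indicator ?E \<omega> * ?k \<omega>) \<partial>P)"
    by (rule nn_integral_eq_integral[OF kint, symmetric]) (auto intro!: AE_I2)
  also have "\<dots> = (\<integral>\<^sup>+\<omega>. indicator B (sample_path X i \<omega>) * emeasure (K i (X i \<omega>)) A \<partial>P)"
  proof (rule nn_integral_cong)
    fix \<omega> assume w: "\<omega> \<in> space P"
    interpret k: prob_space "K i (X i \<omega>)" by (rule Kp[OF w])
    show "ennreal (indicator ?E \<omega> * ?k \<omega>) = indicator B (sample_path X i \<omega>) * emeasure (K i (X i \<omega>)) A"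
      using w by (auto simp: indicator_def k.emeasure_eq_measure)
  qed
  finally show ?thesis .
qed

lemma measurable_sample_path:
  assumes "markov_chain P N T K X" "i \<le> N"
  shows "sample_path X i \<in> measurable P (path_space T i)"
  unfolding sample_path_def[abs_def] path_space_def
  by (rule measurable_restrict) (use assms in \<open>auto simp: markov_chain_def\<close>)

lemma markov_chain_kernels:
  assumes chain: "markov_chain P N T K X" and nu_eq: "\<nu> = distr P (borel_sets_of (T 1)) (X 1)"
  shows "markov_kernels N T K \<nu>"
proof
  interpret P: prob_space P using chain by (simp add: markov_chain_def)
  show "\<nu> \<in> space (prob_algebra (borel_sets_of (T 1)))" if "0 < N"
    using chain that by (auto simp: nu_eq markov_chain_def space_prob_algebra intro!: P.prob_space_distr)
qed (use chain in \<open>auto simp: markov_chain_def\<close>)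

text \<open>Statements about the chain become statements about \<open>traj\<close> started from the
  empty path. Both laws are finite, and by induction they agree on boxes.\<close>

lemma distr_sample_path:
  fixes P :: "'w measure" and T :: "nat \<Rightarrow> 'a topology"
  assumes chain: "markov_chain P N T K X" and nu_eq: "\<nu> = distr P (borel_sets_of (T 1)) (X 1)" and "i \<le> N"
  shows "distr P (path_space T i) (sample_path X i) = markov_kernels.traj T K \<nu> 0 i (\<lambda>_. undefined)"
proof -
  interpret P: prob_space P using chain by (simp add: markov_chain_def)
  interpret markov_kernels N T K \<nu>
    by (rule markov_chain_kernels[OF chain nu_eq])
  show ?thesis using \<open>i \<le> N\<close>
  proof (induction i)
    case 0
    have "sample_path X 0 = (\<lambda>\<omega> _. undefined)" by (auto simp: sample_path_def fun_eq_iff)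
    then show ?case by simp
  next
    case (Suc i)
    let ?u = "\<lambda>_. undefined"
    have iN: "i < N" using Suc by simp
    have IH: "distr P (path_space T i) (sample_path X i) = traj 0 i ?u" using Suc by simp
    have Sm: "sample_path X i \<in> measurable P (path_space T i)" "sample_path X (Suc i) \<in> measurable P (path_space T (Suc i))"
      using measurable_sample_path[OF chain] Suc by auto
    have st: "step i \<in> measurable (path_space T i) (subprob_algebra (path_space T (Suc i)))"
      using iN by (intro measurable_prob_algebraD measurable_step)
    show ?case
    proof (rule measure_eqI_PiM_finite[where I = "{1..Suc i}" and M = "\<lambda>j. borel_sets_of (T j)"
          and A = "\<lambda>_. \<Pi>\<^sub>E j\<in>{1..Suc i}. space (borel_sets_of (T j))"])
      show "sets (distr P (path_space T (Suc i)) (sample_path X (Suc i))) = sets (\<Pi>\<^sub>M j\<in>{1..Suc i}. borel_sets_of (T j))"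
        by (simp add: path_space_def)
      show "sets (traj 0 (Suc i) ?u) = sets (\<Pi>\<^sub>M j\<in>{1..Suc i}. borel_sets_of (T j))"
        using traj_space(2)[of 0 "Suc i" ?u] Suc.prems by (simp add: path_space_def)
      fix A :: "nat \<Rightarrow> 'a set" assume A: "\<And>j. j \<in> {1..Suc i} \<Longrightarrow> A j \<in> sets (borel_sets_of (T j))"
      let ?B = "\<Pi>\<^sub>E j\<in>{1..i}. A j" and ?A = "A (Suc i)"
      have PA: "(\<Pi>\<^sub>E j\<in>{1..Suc i}. A j) \<in> sets (path_space T (Suc i))"
        unfolding path_space_def by (rule sets_PiM_I_finite) (use A in auto)
      have B: "?B \<in> sets (path_space T i)"
        unfolding path_space_def by (rule sets_PiM_I_finite) (use A in auto)
      have "emeasure (distr P (path_space T (Suc i)) (sample_path X (Suc i))) (\<Pi>\<^sub>E j\<in>{1..Suc i}. A j)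
          = emeasure P {\<omega> \<in> space P. sample_path X i \<omega> \<in> ?B \<and> X (Suc i) \<omega> \<in> ?A}"
        unfolding emeasure_distr[OF Sm(2) PA]
        by (rule arg_cong[where f = "emeasure P"])
          (auto simp: sample_path_def PiE_iff atLeastAtMostSuc_conv)
      also have "\<dots> = (\<integral>\<^sup>+\<omega>. indicator ?B (sample_path X i \<omega>) * emeasure (Q i (sample_path X i \<omega>)) ?A \<partial>P)"
      proof (cases "i = 0")
        \<comment> \<open>The Markov condition begins at time 1. The first state has law \<nu> by
          the choice of \<nu>, and the only past is the empty path.\<close>
        case True
        have "{\<omega> \<in> space P. sample_path X i \<omega> \<in> ?B \<and> X (Suc i) \<omega> \<in> ?A} = X (Suc 0) -` A (Suc 0) \<inter> space P"
          using True by (auto simp: sample_path_def)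
        moreover have "X (Suc 0) \<in> measurable P (borel_sets_of (T (Suc 0)))"
          using chain iN by (auto simp: markov_chain_def)
        moreover have "sample_path X i \<omega> = ?u" for \<omega> using True by (auto simp: sample_path_def)
        moreover have "emeasure \<nu> (A (Suc 0)) = emeasure P (X (Suc 0) -` A (Suc 0) \<inter> space P)"
          unfolding nu_eq One_nat_def using calculation A[of "Suc 0"] True by (intro emeasure_distr) auto
        moreover have "Q 0 x = \<nu>" for x by (simp add: Q_def)
        ultimately show ?thesis using True by (simp add: P.emeasure_space_1)
      next
        case False
        then have "Q i (sample_path X i \<omega>) = K i (X i \<omega>)" for \<omega> by (simp add: Q_def sample_path_def)
        then show ?thesis
          using markov_chain_step_emeasure[OF chain _ iN B, of ?A] A False by simp
      qed
      also have "\<dots> = (\<integral>\<^sup>+\<omega>. emeasure (step i (sample_path X i \<omega>)) (\<Pi>\<^sub>E j\<in>{1..Suc i}. A j) \<partial>P)"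
        by (intro nn_integral_cong emeasure_step_PiE[symmetric] iN measurable_space[OF Sm(1)] A)
      also have "\<dots> = (\<integral>\<^sup>+x. emeasure (step i x) (\<Pi>\<^sub>E j\<in>{1..Suc i}. A j) \<partial>distr P (path_space T i) (sample_path X i))"
        by (rule nn_integral_distr[symmetric, OF Sm(1)])
          (unfold measurable_distr_eq1, rule measurable_compose[OF st
              measurable_emeasure_subprob_algebra[OF PA]])
      also have "\<dots> = emeasure (traj 0 i ?u \<bind> step i) (\<Pi>\<^sub>E j\<in>{1..Suc i}. A j)"
        unfolding IH
      proof (rule emeasure_bind[symmetric, OF _ _ PA])
        have i0: "0 + i \<le> N" using iN by simp
        show "space (traj 0 i ?u) \<noteq> {}" by (rule traj_space(4)[OF i0 undefined_path_space])
        show "step i \<in> measurable (traj 0 i ?u) (subprob_algebra (path_space T (Suc i)))"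
          by (rule measurable_on_traj[OF i0 undefined_path_space]) (simp add: st)
      qed
      finally show "emeasure (distr P (path_space T (Suc i)) (sample_path X (Suc i))) (\<Pi>\<^sub>E j\<in>{1..Suc i}. A j)
          = emeasure (traj 0 (Suc i) ?u) (\<Pi>\<^sub>E j\<in>{1..Suc i}. A j)"
        by simp
    next
      show "range (\<lambda>_. \<Pi>\<^sub>E j\<in>{1..Suc i}. space (borel_sets_of (T j))) \<subseteq> prod_algebra {1..Suc i} (\<lambda>j. borel_sets_of (T j))"
        by (auto intro!: prod_algebraI_finite sets.top simp del: space_borel_sets_of)
      show "emeasure (distr P (path_space T (Suc i)) (sample_path X (Suc i)))
          (\<Pi>\<^sub>E j\<in>{1..Suc i}. space (borel_sets_of (T j))) \<noteq> \<infinity>" for n :: nat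
      proof -
        interpret D: prob_space "distr P (path_space T (Suc i)) (sample_path X (Suc i))"
          by (rule P.prob_space_distr[OF Sm(2)])
        show ?thesis using D.emeasure_finite by simp
      qed
    qed (auto simp: space_PiM)
  qed
qed

section \<open>Blocks and the moment generating function\<close>

text \<open>Operator norm bound for the mixing matrix with entries \<open>1, 1, \<epsilon>, \<epsilon>\<^sup>2, \<dots>\<close> on and above the diagonal.\<close>

lemma sum_squares_recursion_le:
  fixes B C :: "nat \<Rightarrow> real"
  assumes rec: "\<And>k. k < N \<Longrightarrow> B k = C k + \<epsilon> * B (Suc k)" and "B N = 0"
    and \<epsilon>: "0 \<le> \<epsilon>" "\<epsilon> < 1"
  shows "(\<Sum>k<N. (C k + B (Suc k))\<^sup>2) \<le> ((2 - \<epsilon>) / (1 - \<epsilon>))\<^sup>2 * (\<Sum>k<N. (C k)\<^sup>2)"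
proof -
  let ?n = "\<lambda>f. L2_set f {..<N}"
  \<comment> \<open>By \<open>B N = 0\<close> the shifted sequence loses \<open>B 0\<close> and
    gains only a zero.\<close>
  have shift: "?n (\<lambda>k. B (Suc k)) \<le> ?n B"
  proof -
    have "(\<Sum>k<N. (B (Suc k))\<^sup>2) \<le> (\<Sum>k<Suc N. (B k)\<^sup>2)"
      unfolding sum.lessThan_Suc_shift by simp
    also have "\<dots> = (\<Sum>k<N. (B k)\<^sup>2)" using \<open>B N = 0\<close> by simp
    finally show ?thesis by (simp add: L2_set_def)
  qed
  have "?n B = ?n (\<lambda>k. C k + \<epsilon> * B (Suc k))" by (rule L2_set_cong) (simp_all add: rec)
  also have "\<dots> \<le> ?n C + ?n (\<lambda>k. \<epsilon> * B (Suc k))" by (rule L2_set_triangle_ineq)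
  also have "?n (\<lambda>k. \<epsilon> * B (Suc k)) = \<epsilon> * ?n (\<lambda>k. B (Suc k))"
    by (rule L2_set_right_distrib[symmetric, OF \<epsilon>(1)])
  also have "\<dots> \<le> \<epsilon> * ?n B" by (rule mult_left_mono[OF shift \<epsilon>(1)])
  \<comment> \<open>\<open>?n B \<le> ?n C + \<epsilon> * ?n B\<close> is solved for
    \<open>?n B\<close>. The final constant is then \<open>1 + 1 / (1 - \<epsilon>) = (2 -
    \<epsilon>) / (1 - \<epsilon>)\<close>.\<close>
  finally have B: "?n B \<le> ?n C / (1 - \<epsilon>)" using \<epsilon> by (simp add: field_simps)
  have "?n (\<lambda>k. C k + B (Suc k)) \<le> ?n C + ?n (\<lambda>k. B (Suc k))" by (rule L2_set_triangle_ineq)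
  also have "\<dots> \<le> ?n C + ?n C / (1 - \<epsilon>)" using shift B by linarith
  also have "\<dots> = (2 - \<epsilon>) / (1 - \<epsilon>) * ?n C" using \<epsilon> by (simp add: field_simps)
  finally have "(?n (\<lambda>k. C k + B (Suc k)))\<^sup>2 \<le> ((2 - \<epsilon>) / (1 - \<epsilon>) * ?n C)\<^sup>2"
    by (rule power_mono) simp
  moreover have "(?n g)\<^sup>2 = (\<Sum>k<N. (g k)\<^sup>2)" for g by (simp add: L2_set_def sum_nonneg)
  ultimately show ?thesis by (simp only: power_mult_distrib)
qed

context lipschitz_markov
begin

text \<open>A backward pass over the block boundaries supplies the constants \<open>B k\<close>, a
  forward pass multiplies the one-block bounds of \<open>mgf_step\<close>, and the resulting sum of
  squares is compared with that of \<open>c\<close>.\<close>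

lemma mgf_bound:
  assumes \<tau>: "1 \<le> \<tau>" and \<epsilon>: "0 \<le> \<epsilon>" "\<epsilon> < 1"
    and tv: "\<And>a u v D. 1 \<le> a \<Longrightarrow> a + \<tau> \<le> N \<Longrightarrow> u \<in> topspace (T a) \<Longrightarrow> v \<in> topspace (T a) \<Longrightarrow>
           D \<in> sets (borel_sets_of (T (a + \<tau>))) \<Longrightarrow>
           measure (cond_law T K a \<tau> u) D \<le> measure (cond_law T K a \<tau> v) D + \<epsilon>"
    and l: "0 < l" and x0: "x0 \<in> space (path_space T 0)"
  shows "(\<integral>\<^sup>+w. ennreal (exp (l * f w)) \<partial>traj 0 N x0)
     \<le> ennreal (exp (l * F 0 x0 + l\<^sup>2 * (real \<tau> * ((2 - \<epsilon>) / (1 - \<epsilon>))\<^sup>2 * (\<Sum>j\<in>{1..N}. (c j)\<^sup>2)) / 8))"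
proof -
  \<comment> \<open>Boundaries are capped at \<open>N\<close>. As \<open>1 \<le> \<tau>\<close>, a
    number \<open>N\<close> of blocks always reaches the end; surplus blocks are empty.\<close>
  define b where "b k = min (k * \<tau>) N" for k
  \<comment> \<open>\<open>C k\<close> is the weight of the block that follows \<open>b k\<close>,
    so the recursion reads \<open>B k = C k + \<epsilon> * B (Suc k)\<close>; the \<open>B\<close>
    below solves it with \<open>B N = 0\<close>.\<close>
  define C where "C k = (\<Sum>j\<in>{b k<..b (Suc k)}. c j)" for k
  define B where "B k = (\<Sum>j\<in>{k..<N}. \<epsilon> ^ (j - k) * C j)" for k
  have b_mono: "b k \<le> b (Suc k)" for k by (simp add: b_def)
  have b_le: "b k \<le> N" for k by (simp add: b_def)
  have bN: "b N = N" using \<tau> by (cases \<tau>) (simp_all add: b_def)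
  have C_nonneg: "0 \<le> C k" for k
    unfolding C_def using b_le[of "Suc k"] by (intro sum_nonneg c_nonneg) auto
  have B_nonneg: "0 \<le> B k" for k
    unfolding B_def using \<epsilon> by (intro sum_nonneg mult_nonneg_nonneg C_nonneg) auto
  have BN: "B N = 0" by (simp add: B_def)
  have B_rec: "B k = C k + \<epsilon> * B (Suc k)" if "k < N" for k
  proof -
    have "(\<Sum>j\<in>{Suc k..<N}. \<epsilon> ^ (j - k) * C j) = \<epsilon> * B (Suc k)"
      unfolding B_def sum_distrib_left
    proof (rule sum.cong[OF refl])
      fix j assume "j \<in> {Suc k..<N}"
      then have "j - k = Suc (j - Suc k)" by (simp add: Suc_diff_Suc)
      then show "\<epsilon> ^ (j - k) * C j = \<epsilon> * (\<epsilon> ^ (j - Suc k) * C j)" by simp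
    qed
    then show ?thesis using that by (simp add: B_def sum.atLeast_Suc_lessThan)
  qed
  have B_end: "B k = 0" if "b k = N" for k
  proof -
    have "C j = 0" if "k \<le> j" for j
    proof -
      have "N \<le> k * \<tau>" using \<open>b k = N\<close> by (simp add: b_def)
      also have "\<dots> \<le> j * \<tau>" using that by simp
      finally have "b j = N" by (simp add: b_def)
      then show ?thesis using b_le[of "Suc j"] by (simp add: C_def)
    qed
    then show ?thesis by (simp add: B_def)
  qed
  \<comment> \<open>Backward induction from \<open>lip N 0\<close>. It stops at
    \<open>k = 1\<close>, as there is no current state at time 0.\<close>
  have lip_b: "lip (b k) (B k)" if "1 \<le> k" "k \<le> N" for k
    using that(2,1)
  proof (induction k rule: inc_induct)
    case base
    show ?case using lip_last by (simp add: bN BN)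
  next
    case (step k)
    show ?case
    proof (cases "b k = N")
      case True
      then show ?thesis using lip_last B_end[OF True] by simp
    next
      case False
      then have bk: "b k = k * \<tau>" "k * \<tau> < N" by (auto simp: b_def min_def split: if_splits)
      define m where "m = b (Suc k) - b k"
      have bm: "b (Suc k) = b k + m" using b_mono[of k] by (simp add: m_def)
      have m: "1 \<le> m" using bk \<tau> by (auto simp: m_def b_def min_def)
      have a: "1 \<le> b k" using bk \<tau> step.prems by simp
      have IH: "lip (b k + m) (B (Suc k))" using step.IH bm by simp
      have mN: "b k + m \<le> N" using b_le[of "Suc k"] bm by simp
      show ?thesis
      proof (cases "m = \<tau>")
        case True
        have "lip (b k) ((\<Sum>j\<in>{b k<..b k + m}. c j) + \<epsilon> * B (Suc k))"
          by (rule lip_step[OF a mN m IH B_nonneg \<epsilon>(1)]) (use tv[OF a] mN True in simp)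
        then show ?thesis using B_rec[OF step.hyps(2)] by (simp add: C_def bm)
      next
        \<comment> \<open>The last block may be shorter than \<tau>, where nothing is known about
          mixing. The trivial bound 1 suffices, because \<open>B (Suc k) = 0\<close> there.\<close>
        case False
        then have "b (Suc k) = N" using bk by (auto simp: m_def b_def min_def split: if_splits)
        then have B0: "B (Suc k) = 0" by (rule B_end)
        have "lip (b k) ((\<Sum>j\<in>{b k<..b k + m}. c j) + 1 * B (Suc k))"
        proof (rule lip_step[OF a mN m IH B_nonneg zero_le_one])
          fix u v D assume uv: "u \<in> topspace (T (b k))" "v \<in> topspace (T (b k))"
          interpret u: prob_space "cond_law T K (b k) m u"
            using measurable_space[OF measurable_cond_law[OF a mN], of u] uv by (simp add: space_prob_algebra)
          show "measure (cond_law T K (b k) m u) D \<le> measure (cond_law T K (b k) m v) D + 1"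
            using u.prob_le_1[of D] measure_nonneg[of "cond_law T K (b k) m v" D] by linarith
        qed
        then show ?thesis using B_rec[OF step.hyps(2)] by (simp add: C_def bm B0)
      qed
    qed
  qed
  \<comment> \<open>Forward induction: conditionally on the path up to \<open>b k\<close>, the next
    block contributes at most the factor \<open>?r\<close> below.\<close>
  have mgf: "(\<integral>\<^sup>+w. ennreal (exp (l * F (b k) w)) \<partial>traj 0 (b k) x0)
     \<le> ennreal (exp (l * F 0 x0 + l\<^sup>2 * (\<Sum>i<k. (C i + B (Suc i))\<^sup>2) / 8))" if "k \<le> N" for k
    using that
  proof (induction k)
    case 0
    have "b 0 = 0" by (simp add: b_def)
    then show ?case
      using nn_integral_return[OF x0, of "\<lambda>w. ennreal (exp (l * F 0 w))"] measurable_F[of 0] by simp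
  next
    case (Suc k)
    define m where "m = b (Suc k) - b k"
    have bm: "b (Suc k) = b k + m" using b_mono[of k] by (simp add: m_def)
    have mN: "b k + m \<le> N" using b_le[of "Suc k"] bm by simp
    have lipk: "lip (b k + m) (B (Suc k))" using lip_b[of "Suc k"] Suc.prems bm by simp
    let ?r = "exp (l\<^sup>2 * (C k + B (Suc k))\<^sup>2 / 8)"
    have tm: "traj (b k) m \<in> measurable (traj 0 (b k) x0) (subprob_algebra (path_space T (b k + m)))"
    proof (rule measurable_on_traj[OF _ x0])
      show "0 + b k \<le> N" using b_le by simp
      show "traj (b k) m \<in> measurable (path_space T (0 + b k)) (subprob_algebra (path_space T (b k + m)))"
        unfolding add_0 by (rule measurable_prob_algebraD[OF measurable_traj[OF mN]])
    qed
    have Fm: "(\<lambda>w. ennreal (exp (l * F a w))) \<in> borel_measurable (path_space T a)" if "a \<le> N" for a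
      using measurable_F[OF that] by measurable
    have "(\<integral>\<^sup>+w. ennreal (exp (l * F (b (Suc k)) w)) \<partial>traj 0 (b (Suc k)) x0)
        = (\<integral>\<^sup>+x. \<integral>\<^sup>+w. ennreal (exp (l * F (b k + m) w)) \<partial>traj (b k) m x \<partial>traj 0 (b k) x0)"
      using traj_add[of 0 "b k" m x0] mN x0 nn_integral_bind[OF Fm[OF mN] tm] by (simp add: bm)
    also have "\<dots> \<le> (\<integral>\<^sup>+x. ennreal ?r * ennreal (exp (l * F (b k) x)) \<partial>traj 0 (b k) x0)"
    proof (rule nn_integral_mono)
      fix x assume "x \<in> space (traj 0 (b k) x0)"
      then have x: "x \<in> space (path_space T (b k))" using traj_space(3)[of 0 "b k" x0] x0 b_le[of k] by simp
      have "(\<integral>\<^sup>+w. ennreal (exp (l * F (b k + m) w)) \<partial>traj (b k) m x)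
         \<le> ennreal (exp (l * F (b k) x + l\<^sup>2 * (C k + B (Suc k))\<^sup>2 / 8))"
        using mgf_step[OF mN lipk B_nonneg x l] by (simp add: C_def bm)
      also have "\<dots> = ennreal ?r * ennreal (exp (l * F (b k) x))"
        by (simp add: exp_add mult.commute flip: ennreal_mult)
      finally show "(\<integral>\<^sup>+w. ennreal (exp (l * F (b k + m) w)) \<partial>traj (b k) m x)
          \<le> ennreal ?r * ennreal (exp (l * F (b k) x))" .
    qed
    also have "\<dots> = ennreal ?r * (\<integral>\<^sup>+x. ennreal (exp (l * F (b k) x)) \<partial>traj 0 (b k) x0)"
    proof (rule nn_integral_cmult, rule measurable_on_traj[OF _ x0])
      show "0 + b k \<le> N" using b_le by simp
      show "(\<lambda>x. ennreal (exp (l * F (b k) x))) \<in> borel_measurable (path_space T (0 + b k))"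
        unfolding add_0 by (rule Fm[OF b_le])
    qed
    also have "\<dots> \<le> ennreal ?r * ennreal (exp (l * F 0 x0 + l\<^sup>2 * (\<Sum>i<k. (C i + B (Suc i))\<^sup>2) / 8))"
      using Suc by (intro mult_left_mono) auto
    also have "\<dots> = ennreal (exp (l * F 0 x0 + l\<^sup>2 * (\<Sum>i<Suc k. (C i + B (Suc i))\<^sup>2) / 8))"
      by (simp add: algebra_simps add_divide_distrib flip: ennreal_mult exp_add)
    finally show ?case .
  qed
  \<comment> \<open>Cauchy-Schwarz in each block of at most \<tau> indices; this is where the factor
    \<tau> in the variance proxy arises.\<close>
  have C2: "(\<Sum>k<N. (C k)\<^sup>2) \<le> real \<tau> * (\<Sum>j\<in>{1..N}. (c j)\<^sup>2)"
  proof -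
    have tele: "(\<Sum>k<n. \<Sum>j\<in>{b k<..b (Suc k)}. (c j)\<^sup>2) = (\<Sum>j\<in>{0<..b n}. (c j)\<^sup>2)" for n
    proof (induction n)
      case (Suc n)
      have "{0<..b (Suc n)} = {0<..b n} \<union> {b n<..b (Suc n)}" using b_mono[of n] by auto
      then show ?case using Suc by (simp add: sum.union_disjoint)
    qed (simp add: b_def)
    have "(C k)\<^sup>2 \<le> real \<tau> * (\<Sum>j\<in>{b k<..b (Suc k)}. (c j)\<^sup>2)" for k
    proof -
      have "(C k)\<^sup>2 \<le> (\<Sum>j\<in>{b k<..b (Suc k)}. (c j)\<^sup>2) * card {b k<..b (Suc k)}"
        unfolding C_def by (rule sum_squared_le_sum_of_squares)
      also have "\<dots> \<le> (\<Sum>j\<in>{b k<..b (Suc k)}. (c j)\<^sup>2) * real \<tau>"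
      proof (rule mult_left_mono)
        have "card {b k<..b (Suc k)} \<le> \<tau>" by (auto simp: b_def min_def)
        then show "real (card {b k<..b (Suc k)}) \<le> real \<tau>" by simp
      qed (simp add: sum_nonneg)
      finally show ?thesis by (simp add: mult.commute)
    qed
    then have "(\<Sum>k<N. (C k)\<^sup>2) \<le> real \<tau> * (\<Sum>k<N. \<Sum>j\<in>{b k<..b (Suc k)}. (c j)\<^sup>2)"
      unfolding sum_distrib_left by (rule sum_mono)
    also have "\<dots> = real \<tau> * (\<Sum>j\<in>{0<..b N}. (c j)\<^sup>2)" by (simp only: tele)
    also have "{0<..b N} = {1..N}" by (auto simp: bN)
    finally show ?thesis .
  qed
  have "(\<Sum>k<N. (C k + B (Suc k))\<^sup>2) \<le> ((2 - \<epsilon>) / (1 - \<epsilon>))\<^sup>2 * (\<Sum>k<N. (C k)\<^sup>2)"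
    by (rule sum_squares_recursion_le[OF B_rec BN \<epsilon>])
  also have "\<dots> \<le> ((2 - \<epsilon>) / (1 - \<epsilon>))\<^sup>2 * (real \<tau> * (\<Sum>j\<in>{1..N}. (c j)\<^sup>2))"
    by (rule mult_left_mono[OF C2]) simp
  finally have V: "(\<Sum>k<N. (C k + B (Suc k))\<^sup>2) \<le> real \<tau> * ((2 - \<epsilon>) / (1 - \<epsilon>))\<^sup>2 * (\<Sum>j\<in>{1..N}. (c j)\<^sup>2)"
    by (simp add: mult_ac)
  have "(\<integral>\<^sup>+w. ennreal (exp (l * f w)) \<partial>traj 0 N x0) = (\<integral>\<^sup>+w. ennreal (exp (l * F (b N) w)) \<partial>traj 0 (b N) x0)"
    unfolding bN using traj_space(3)[of 0 N x0] x0 by (intro nn_integral_cong) (simp add: F_last)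
  also have "\<dots> \<le> ennreal (exp (l * F 0 x0 + l\<^sup>2 * (\<Sum>k<N. (C k + B (Suc k))\<^sup>2) / 8))"
    by (rule mgf) simp
  also have "\<dots> \<le> ennreal (exp (l * F 0 x0 + l\<^sup>2 * (real \<tau> * ((2 - \<epsilon>) / (1 - \<epsilon>))\<^sup>2 * (\<Sum>j\<in>{1..N}. (c j)\<^sup>2)) / 8))"
    by (intro ennreal_leI) (use V in \<open>auto intro!: divide_right_mono mult_left_mono\<close>)
  finally show ?thesis .
qed

lemma tail_bound:
  assumes \<tau>: "1 \<le> \<tau>" and \<epsilon>: "0 \<le> \<epsilon>" "\<epsilon> < 1"
    and tv: "\<And>a u v D. 1 \<le> a \<Longrightarrow> a + \<tau> \<le> N \<Longrightarrow> u \<in> topspace (T a) \<Longrightarrow> v \<in> topspace (T a) \<Longrightarrow>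
           D \<in> sets (borel_sets_of (T (a + \<tau>))) \<Longrightarrow>
           measure (cond_law T K a \<tau> u) D \<le> measure (cond_law T K a \<tau> v) D + \<epsilon>"
    and x0: "x0 \<in> space (path_space T 0)" and t: "0 < t"
    and V: "V = real \<tau> * ((2 - \<epsilon>) / (1 - \<epsilon>))\<^sup>2 * (\<Sum>j\<in>{1..N}. (c j)\<^sup>2)" "0 < V"
  shows "measure (traj 0 N x0) {w \<in> space (traj 0 N x0). t \<le> f w - F 0 x0} \<le> exp (- 2 * t\<^sup>2 / V)"
proof -
  interpret prob_space "traj 0 N x0" by (rule traj_space(1)) (use x0 in auto)
  \<comment> \<open>The minimiser of the exponent \<open>- l * t + l\<^sup>2 * V / 8\<close>, whose
    minimum is \<open>- 2 * t\<^sup>2 / V\<close>.\<close>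
  define l where "l = 4 * t / V"
  have l: "0 < l" using t V(2) by (simp add: l_def)
  have fm[measurable]: "f \<in> borel_measurable (traj 0 N x0)"
    using measurable_on_traj[of 0 N x0 f borel] f_meas x0 by simp
  have "emeasure (traj 0 N x0) {w \<in> space (traj 0 N x0). t \<le> f w - F 0 x0}
     \<le> ennreal (exp (- l * t)) * (\<integral>\<^sup>+w\<in>space (traj 0 N x0). ennreal (exp (l * (f w - F 0 x0))) \<partial>traj 0 N x0)"
    by (rule Chernoff_ineq_nn_integral_ge[OF l]) auto
  also have "(\<integral>\<^sup>+w\<in>space (traj 0 N x0). ennreal (exp (l * (f w - F 0 x0))) \<partial>traj 0 N x0)
      = (\<integral>\<^sup>+w. ennreal (exp (- l * F 0 x0)) * ennreal (exp (l * f w)) \<partial>traj 0 N x0)"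
    by (rule nn_integral_cong) (simp add: algebra_simps flip: ennreal_mult exp_add)
  also have "\<dots> = ennreal (exp (- l * F 0 x0)) * (\<integral>\<^sup>+w. ennreal (exp (l * f w)) \<partial>traj 0 N x0)"
    by (rule nn_integral_cmult) measurable
  also have "(\<integral>\<^sup>+w. ennreal (exp (l * f w)) \<partial>traj 0 N x0) \<le> ennreal (exp (l * F 0 x0 + l\<^sup>2 * V / 8))"
    unfolding V(1) by (rule mgf_bound[OF \<tau> \<epsilon> tv l x0])
  finally have "emeasure (traj 0 N x0) {w \<in> space (traj 0 N x0). t \<le> f w - F 0 x0}
     \<le> ennreal (exp (- l * t)) * (ennreal (exp (- l * F 0 x0)) * ennreal (exp (l * F 0 x0 + l\<^sup>2 * V / 8)))"
    by (simp add: mult_left_mono)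
  also have "\<dots> = ennreal (exp (- l * t + l\<^sup>2 * V / 8))"
    by (simp flip: ennreal_mult exp_add)
  also have "- l * t + l\<^sup>2 * V / 8 = - 2 * t\<^sup>2 / V"
    using V(2) by (simp add: l_def field_simps power2_eq_square)
  finally show ?thesis by (simp add: emeasure_eq_measure)
qed

end

section \<open>Back to the chain: mixing time, both tails, and the infimum over \<epsilon>\<close>

lemma mixing_time_props:
  assumes "0 \<le> \<epsilon>"
  shows "1 \<le> mixing_time N T K \<epsilon>" "dbar N T K (mixing_time N T K \<epsilon>) \<le> \<epsilon>"
proof -
  have "1 \<le> max 1 N \<and> dbar N T K (max 1 N) \<le> \<epsilon>" using assms by (simp add: dbar_def)
  then have "1 \<le> mixing_time N T K \<epsilon> \<and> dbar N T K (mixing_time N T K \<epsilon>) \<le> \<epsilon>"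
    unfolding mixing_time_def by (rule LeastI)
  then show "1 \<le> mixing_time N T K \<epsilon>" "dbar N T K (mixing_time N T K \<epsilon>) \<le> \<epsilon>" by auto
qed

text \<open>\<open>tail_bound\<close> carried over along the law of the sampled path, for one fixed
  \<epsilon> and \<tau> its mixing time.\<close>

lemma markov_chain_upper_tail:
  fixes P :: "'w measure" and T :: "nat \<Rightarrow> 'a topology" and f :: "(nat \<Rightarrow> 'a) \<Rightarrow> real"
  assumes polish: "\<And>i. i \<in> {1..N} \<Longrightarrow> polish_topology (T i)"
    and chain: "markov_chain P N T K X"
    and f_meas: "f \<in> borel_measurable (path_space T N)"
    and c_nonneg: "\<And>i. i \<in> {1..N} \<Longrightarrow> 0 \<le> c i"
    and f_lipschitz: "\<And>x y. x \<in> space (path_space T N) \<Longrightarrow> y \<in> space (path_space T N) \<Longrightarrow>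
           f x - f y \<le> (\<Sum>i\<in>{1..N}. c i * of_bool (x i \<noteq> y i))"
    and t: "0 < t" and \<epsilon>: "0 \<le> \<epsilon>" "\<epsilon> < 1" and c_pos: "0 < (\<Sum>j\<in>{1..N}. (c j)\<^sup>2)"
  shows "measure P {\<omega> \<in> space P. t \<le> f (sample_path X N \<omega>) - (\<integral>\<omega>'. f (sample_path X N \<omega>') \<partial>P)}
     \<le> exp (- 2 * t\<^sup>2 / (real (mixing_time N T K \<epsilon>) * ((2 - \<epsilon>) / (1 - \<epsilon>))\<^sup>2 * (\<Sum>j\<in>{1..N}. (c j)\<^sup>2)))"
proof -
  define \<nu> where "\<nu> = distr P (borel_sets_of (T 1)) (X 1)"
  let ?u = "\<lambda>_. undefined" and ?\<tau> = "mixing_time N T K \<epsilon>"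
  interpret markov_kernels N T K \<nu> by (rule markov_chain_kernels[OF chain \<nu>_def])
  interpret lipschitz_markov N T K \<nu> f c
    by unfold_locales (use polish f_meas c_nonneg f_lipschitz in auto)
  note \<tau> = mixing_time_props[OF \<epsilon>(1), of N T K]
  have law: "distr P (path_space T N) (sample_path X N) = traj 0 N ?u"
    by (rule distr_sample_path[OF chain \<nu>_def order_refl])
  have Sm: "sample_path X N \<in> measurable P (path_space T N)"
    by (rule measurable_sample_path[OF chain order_refl])
  have mean: "(\<integral>\<omega>. f (sample_path X N \<omega>) \<partial>P) = F 0 ?u"
    using integral_distr[OF Sm f_meas] by (simp add: law F_def)
  let ?V = "real ?\<tau> * ((2 - \<epsilon>) / (1 - \<epsilon>))\<^sup>2 * (\<Sum>j\<in>{1..N}. (c j)\<^sup>2)"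
  have "measure (traj 0 N ?u) {w \<in> space (traj 0 N ?u). t \<le> f w - F 0 ?u} \<le> exp (- 2 * t\<^sup>2 / ?V)"
  proof (rule tail_bound[OF \<tau>(1) \<epsilon> _ undefined_path_space t refl])
    show "measure (cond_law T K a ?\<tau> u) D \<le> measure (cond_law T K a ?\<tau> v) D + \<epsilon>"
      if "1 \<le> a" "a + ?\<tau> \<le> N" "u \<in> topspace (T a)" "v \<in> topspace (T a)"
        "D \<in> sets (borel_sets_of (T (a + ?\<tau>)))" for a u v D
      using measure_cond_law_le_dbar[OF that] \<tau>(2) by linarith
    show "0 < ?V" using \<tau>(1) \<epsilon> c_pos by (intro mult_pos_pos) auto
  qed
  also have "{w \<in> space (traj 0 N ?u). t \<le> f w - F 0 ?u} = {w \<in> space (path_space T N). t \<le> f w - F 0 ?u}"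
    by (simp flip: law)
  also have "measure (traj 0 N ?u) \<dots>
      = measure P (sample_path X N -` {w \<in> space (path_space T N). t \<le> f w - F 0 ?u} \<inter> space P)"
    unfolding law[symmetric] by (rule measure_distr[OF Sm]) (use f_meas in measurable)
  also have "sample_path X N -` {w \<in> space (path_space T N). t \<le> f w - F 0 ?u} \<inter> space P
      = {\<omega> \<in> space P. t \<le> f (sample_path X N \<omega>) - (\<integral>\<omega>'. f (sample_path X N \<omega>') \<partial>P)}"
    using measurable_space[OF Sm] by (auto simp: mean)
  finally show ?thesis .
qed

theorem corollary2p11:
  fixes P :: "'w measure" and N :: nat
    and T :: "nat \<Rightarrow> 'a topology"
    and K :: "nat \<Rightarrow> 'a \<Rightarrow> 'a measure"
    and X :: "nat \<Rightarrow> 'w \<Rightarrow> 'a"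
    and f :: "(nat \<Rightarrow> 'a) \<Rightarrow> real"
    and c :: "nat \<Rightarrow> real"
    and t :: real
  assumes polish: "\<And>i. i \<in> {1..N} \<Longrightarrow> polish_topology (T i)"
    and chain: "markov_chain P N T K X"
    and f_meas: "f \<in> borel_measurable (path_space T N)"
    and c_nonneg: "\<And>i. i \<in> {1..N} \<Longrightarrow> 0 \<le> c i"
    and f_lipschitz: "\<And>x y. x \<in> space (path_space T N) \<Longrightarrow> y \<in> space (path_space T N) \<Longrightarrow>
           f x - f y \<le> (\<Sum>i\<in>{1..N}. c i * of_bool (x i \<noteq> y i))"
    and t_nonneg: "0 \<le> t"
  shows "measure P {\<omega> \<in> space P. \<bar>f (sample_path X N \<omega>) - (\<integral>\<omega>'. f (sample_path X N \<omega>') \<partial>P)\<bar> \<ge> t}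
           \<le> 2 * exp_quot (- 2 * t\<^sup>2) ((L2_set c {1..N})\<^sup>2 * tau_min N T K)"
proof -
  interpret prob_space P using chain by (simp add: markov_chain_def)
  have Sm[measurable]: "sample_path X N \<in> measurable P (path_space T N)"
    by (rule measurable_sample_path[OF chain order_refl])
  note f_meas[measurable]
  define s where "s = (\<Sum>j\<in>{1..N}. (c j)\<^sup>2)"
  define p where "p = measure P {\<omega> \<in> space P. \<bar>f (sample_path X N \<omega>) - (\<integral>\<omega>'. f (sample_path X N \<omega>') \<partial>P)\<bar> \<ge> t}"
  have p: "0 \<le> p" "p \<le> 1" by (simp_all add: p_def)
  have s: "0 \<le> s" "(L2_set c {1..N})\<^sup>2 = s" by (simp_all add: s_def L2_set_def sum_nonneg)
  \<comment> \<open>For \<open>t = 0\<close> the right-hand side is 2, for \<open>p = 0\<close> it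
    is nonnegative. In the last case both factors of the denominator turn out positive, so
    \<open>exp_quot\<close> is an ordinary quotient there.\<close>
  consider "t = 0" | "p = 0" | "0 < t" "0 < p" using t_nonneg p by linarith
  then have "p \<le> 2 * exp_quot (- 2 * t\<^sup>2) (s * tau_min N T K)"
  proof cases
    case 1
    then show ?thesis using p by (simp add: exp_quot_def)
  next
    case 2
    then show ?thesis by (simp add: exp_quot_def)
  next
    case 3
    \<comment> \<open>If all weights vanish, \<open>f\<close> is constant along the chain and no
      deviation of size \<open>t > 0\<close> occurs, against \<open>p > 0\<close>.\<close>
    have s_pos: "0 < s"
    proof (rule ccontr)
      assume "\<not> 0 < s"
      then have c0: "c j = 0" if "j \<in> {1..N}" for j
        using s(1) that sum_nonneg_eq_0_iff[of "{1..N}" "\<lambda>j. (c j)\<^sup>2"] by (auto simp: s_def)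
      obtain \<omega>0 where w0: "\<omega>0 \<in> space P" using not_empty by blast
      define k where "k = f (sample_path X N \<omega>0)"
      have const: "f (sample_path X N \<omega>) = k" if "\<omega> \<in> space P" for \<omega>
        using f_lipschitz[OF measurable_space[OF Sm that] measurable_space[OF Sm w0]]
          f_lipschitz[OF measurable_space[OF Sm w0] measurable_space[OF Sm that]]
        by (simp add: c0 k_def)
      then have "(\<integral>\<omega>. f (sample_path X N \<omega>) \<partial>P) = (\<integral>\<omega>. k \<partial>P)"
        by (intro Bochner_Integration.integral_cong) auto
      then have "{\<omega> \<in> space P. \<bar>f (sample_path X N \<omega>) - (\<integral>\<omega>'. f (sample_path X N \<omega>') \<partial>P)\<bar> \<ge> t} = {}"
        using const 3 by (auto simp: prob_space)
      then have "p = 0" by (simp only: p_def measure_empty)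
      then show False using 3 by simp
    qed
    have bound: "p \<le> 2 * exp (- 2 * t\<^sup>2 / (real (mixing_time N T K \<epsilon>) * ((2 - \<epsilon>) / (1 - \<epsilon>))\<^sup>2 * s))"
      if \<epsilon>: "0 \<le> \<epsilon>" "\<epsilon> < 1" for \<epsilon>
    proof -
      let ?Y = "\<lambda>\<omega>. f (sample_path X N \<omega>) - (\<integral>\<omega>'. f (sample_path X N \<omega>') \<partial>P)"
      let ?e = "exp (- 2 * t\<^sup>2 / (real (mixing_time N T K \<epsilon>) * ((2 - \<epsilon>) / (1 - \<epsilon>))\<^sup>2 * s))"
      have "p \<le> measure P ({\<omega> \<in> space P. t \<le> ?Y \<omega>} \<union> {\<omega> \<in> space P. t \<le> - ?Y \<omega>})"
        unfolding p_def by (rule finite_measure_mono) auto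
      also have "\<dots> \<le> measure P {\<omega> \<in> space P. t \<le> ?Y \<omega>} + measure P {\<omega> \<in> space P. t \<le> - ?Y \<omega>}"
        by (rule measure_Un_le) measurable
      finally have union: "p \<le> \<dots>" .
      have tail: "measure P {\<omega> \<in> space P. t \<le> g (sample_path X N \<omega>) - (\<integral>\<omega>'. g (sample_path X N \<omega>') \<partial>P)} \<le> ?e"
        if g: "g \<in> borel_measurable (path_space T N)"
          and lip: "\<And>x y. x \<in> space (path_space T N) \<Longrightarrow> y \<in> space (path_space T N) \<Longrightarrow>
             g x - g y \<le> (\<Sum>i\<in>{1..N}. c i * of_bool (x i \<noteq> y i))" for g
      proof -
        have c_pos: "0 < (\<Sum>j\<in>{1..N}. (c j)\<^sup>2)" using s_pos by (simp only: s_def)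
        show ?thesis
          unfolding s_def by (rule markov_chain_upper_tail; fact)
      qed
      have upper: "measure P {\<omega> \<in> space P. t \<le> ?Y \<omega>} \<le> ?e"
        by (rule tail; fact)
      \<comment> \<open>The lower tail of \<open>f\<close> is the upper tail of \<open>- f\<close>,
        which satisfies the same inequality with the points exchanged.\<close>
      have lower: "measure P {\<omega> \<in> space P. t \<le> - ?Y \<omega>} \<le> ?e"
      proof -
        have "(\<lambda>x. - f x) \<in> borel_measurable (path_space T N)" by measurable
        moreover have "- f x - - f y \<le> (\<Sum>i\<in>{1..N}. c i * of_bool (x i \<noteq> y i))"
          if "x \<in> space (path_space T N)" "y \<in> space (path_space T N)" for x y
        proof -
          have "(\<Sum>i\<in>{1..N}. c i * of_bool (y i \<noteq> x i)) = (\<Sum>i\<in>{1..N}. c i * of_bool (x i \<noteq> y i))"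
            by (rule sum.cong) auto
          then show ?thesis using f_lipschitz[OF that(2,1)] by linarith
        qed
        ultimately have "measure P {\<omega> \<in> space P. t \<le> - f (sample_path X N \<omega>) - (\<integral>\<omega>'. - f (sample_path X N \<omega>') \<partial>P)} \<le> ?e"
          by (rule tail)
        moreover have "- f (sample_path X N \<omega>) - (\<integral>\<omega>'. - f (sample_path X N \<omega>') \<partial>P) = - ?Y \<omega>" for \<omega>
          by simp
        ultimately show ?thesis by (simp only:)
      qed
      from union upper lower show ?thesis by linarith
    qed
    \<comment> \<open>No minimiser over \<epsilon> has to be found. With
      \<open>p = 2 * exp (- L)\<close>, where \<open>L > 0\<close> by \<open>p \<le> 1\<close>, each
      bound becomes a lower bound \<open>2 * t\<^sup>2 / (s * L)\<close>, free of \<epsilon>, on the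
      quantity under the infimum. It passes to \<open>tau_min\<close>, also shows it positive, and
      is then solved back for \<open>p\<close>.\<close>
    define L where "L = ln (2 / p)"
    have L: "0 < L" "p = 2 * exp (- L)"
      using 3 p by (auto simp: L_def exp_minus intro!: ln_gt_zero)
    have le: "2 * t\<^sup>2 / (s * L) \<le> real (mixing_time N T K \<epsilon>) * ((2 - \<epsilon>) / (1 - \<epsilon>))\<^sup>2"
      if \<epsilon>: "\<epsilon> \<in> {0..<1}" for \<epsilon>
    proof -
      let ?a = "real (mixing_time N T K \<epsilon>) * ((2 - \<epsilon>) / (1 - \<epsilon>))\<^sup>2"
      have a: "0 < ?a" using \<epsilon> mixing_time_props(1)[of \<epsilon> N T K] by (intro mult_pos_pos) auto
      have "exp (- L) \<le> exp (- 2 * t\<^sup>2 / (?a * s))" using bound[of \<epsilon>] \<epsilon> L(2) by simp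
      then have "2 * t\<^sup>2 / (?a * s) \<le> L" by simp
      then show ?thesis using a s_pos L(1) by (simp only: pos_divide_le_eq mult_pos_pos mult_ac)
    qed
    have le_tau: "2 * t\<^sup>2 / (s * L) \<le> tau_min N T K"
      unfolding tau_min_def by (rule cINF_greatest) (auto intro: le)
    moreover have "0 < 2 * t\<^sup>2 / (s * L)" using 3 s_pos L by simp
    ultimately have tau: "0 < tau_min N T K" by linarith
    have "2 * t\<^sup>2 / (s * tau_min N T K) \<le> L"
      using le_tau tau s_pos L(1) by (simp only: pos_divide_le_eq mult_pos_pos mult_ac)
    then have "p \<le> 2 * exp (- 2 * t\<^sup>2 / (s * tau_min N T K))" using L(2) by simp
    then show ?thesis using s_pos tau by (simp add: exp_quot_def)
  qed
  then show ?thesis unfolding p_def s(2) .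
qed

end
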